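(* The set of compact composition operators on $H^2_{\bf ball}$ is arcwise connected, with respect to the operator norm topology, in the set of all composition operators. That is, for any two compact composition operators $C_\varphi$ and $C_\chi$ on $H^2_{\bf ball}$ there is an operator-norm continuous path of compact composition operators on $H^2_{\bf ball}$, parametrized by $[0,1]$, joining $C_\varphi$ to $C_\chi$.
   Context: $n\ge1$; $\mathcal H$ is a separable infinite dimensional complex Hilbert space. $\mathbb F_n^+$ is the free semigroup with generators $g_1,\ldots,g_n$ and identity $g_0$; $|g_0|=0$, $|\alpha|=k$ if $\alpha=g_{i_1}\cdots g_{i_k}$; $X_\alpha:=X_{i_1}\cdots X_{i_k}$, $X_{g_0}:=I$. $[B(\mathcal H)^n]_1:=\{(X_1,\ldots,X_n)\in B(\mathcal H)^n:\ \|X_1X_1^*+\cdots+X_nX_n^*\|^{1/2}<1\}$. A free holomorphic function $f:[B(\mathcal H)^n]_1\to B(\mathcal H)$ is a map $f(X)=\sum_{k=0}^\infty\sum_{|\alpha|=k}a_\alpha X_\alpha$ (series over $k$ converging in operator norm) with $a_\alpha\in\mathbb C$ and $\limsup_{k\to\infty}(\sum_{|\alpha|=k}|a_\alpha|^2)^{1/2k}\le1$. A free holomorphic self-map $\varphi=(\varphi_1,\ldots,\varphi_n)$ of $[B(\mathcal H)^n]_1$ has each $\varphi_i$ free holomorphic and maps $[B(\mathcal H)^n]_1$ into itself. With $\varphi_\alpha:=\varphi_{i_1}\cdots\varphi_{i_k}$, the composition is $(f\circ\varphi)(X)=\sum_{k=0}^\infty\sum_{|\alpha|=k}a_\alpha\varphi_\alpha(X)$.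 $H^2_{\bf ball}$ is the Hilbert space of free holomorphic functions $f=\sum_\alpha a_\alpha X_\alpha$ on $[B(\mathcal H)^n]_1$ with $\|f\|_2^2:=\sum_\alpha|a_\alpha|^2<\infty$. A composition operator on $H^2_{\bf ball}$ is an operator $C_\varphi f:=f\circ\varphi$ with $\varphi$ a free holomorphic self-map of $[B(\mathcal H)^n]_1$; it is always bounded. *)

theory Defs
  imports "HOL-Analysis.Analysis"
begin

section \<open>Complex Hilbert spaces\<close>

text \<open>
  The real inner product underlying the norm is the real part of \<open>cinner\<close>, and \<open>cinner\<close> is
  linear in its first argument. Positive definiteness is inherited from \<open>real_inner\<close>.
\<close>

class complex_inner = real_inner +
  fixes scaleC :: "complex \<Rightarrow> 'a \<Rightarrow> 'a" (infixr \<open>*\<^sub>C\<close> 75)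
    and cinner :: "'a \<Rightarrow> 'a \<Rightarrow> complex"
  assumes scaleC_add_right: "c *\<^sub>C (x + y) = c *\<^sub>C x + c *\<^sub>C y"
    and scaleC_add_left: "(c + d) *\<^sub>C x = c *\<^sub>C x + d *\<^sub>C x"
    and scaleC_scaleC: "c *\<^sub>C d *\<^sub>C x = (c * d) *\<^sub>C x"
    and scaleR_scaleC: "r *\<^sub>R x = complex_of_real r *\<^sub>C x"
    and cinner_commute: "cinner x y = cnj (cinner y x)"
    and cinner_add_left: "cinner (x + y) z = cinner x z + cinner y z"
    and cinner_scaleC_left: "cinner (c *\<^sub>C x) y = c * cinner x y"
    and inner_eq_Re_cinner: "inner x y = Re (cinner x y)"

class complex_hilbert = complex_inner + complete_space

lemma vector_space_scaleC: "vector_space (scaleC :: complex \<Rightarrow> 'a \<Rightarrow> 'a::complex_inner)"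
proof
  show "1 *\<^sub>C x = x" for x :: 'a
    using scaleR_scaleC[of 1 x] by simp
qed (simp_all add: scaleC_add_right scaleC_add_left scaleC_scaleC)

lemma norm_scaleC: "norm (c *\<^sub>C x) = cmod c * norm (x :: 'a::complex_inner)"
proof -
  have "cinner (c *\<^sub>C x) (c *\<^sub>C x) = c * cnj (cinner (c *\<^sub>C x) x)"
    by (metis cinner_commute cinner_scaleC_left)
  also have "\<dots> = (c * cnj c) * cnj (cinner x x)"
    by (simp add: cinner_scaleC_left)
  finally have "cinner (c *\<^sub>C x) (c *\<^sub>C x) = complex_of_real ((cmod c)\<^sup>2) * cnj (cinner x x)"
    by (simp only: complex_norm_square)
  then have "inner (c *\<^sub>C x) (c *\<^sub>C x) = (cmod c)\<^sup>2 * inner x x"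
    by (simp only: inner_eq_Re_cinner) simp
  then show ?thesis
    by (simp add: norm_eq_sqrt_inner real_sqrt_mult)
qed

definition infinite_dimensional :: "'h::complex_hilbert itself \<Rightarrow> bool" where
  "infinite_dimensional _ \<longleftrightarrow> \<not> (\<exists>B :: 'h set. finite B \<and> module.span scaleC B = UNIV)"


section \<open>Bounded operators and the open operatorial unit ball\<close>

text \<open>
  \<open>'h \<Rightarrow>\<^sub>L 'h\<close> consists of the bounded \<^emph>\<open>real\<close>-linear operators; \<open>B(H)\<close> is the subset \<open>BH\<close> of
  complex-linear ones, with the same operator norm.
\<close>

type_synonym 'h bop = "'h \<Rightarrow>\<^sub>L 'h"

text \<open>
  An \<open>n\<close>-tuple of operators is indexed by a finite type \<open>'n\<close> (so \<open>n = CARD('n) \<ge> 1\<close>), and the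
  free semigroup on \<open>n\<close> generators is \<open>'n list\<close> with concatenation, the empty word being
  its identity.
\<close>

type_synonym ('n, 'h) optuple = "'n \<Rightarrow> 'h bop"

definition BH :: "'h::complex_hilbert bop set" where
  "BH = {T. \<forall>c x. blinfun_apply T (c *\<^sub>C x) = c *\<^sub>C blinfun_apply T x}"

lift_definition scaleC_bop :: "complex \<Rightarrow> 'h::complex_hilbert bop \<Rightarrow> 'h bop"
  is "\<lambda>c T x. c *\<^sub>C T x"
proof -
  fix c and T :: "'h \<Rightarrow> 'h"
  assume T: "bounded_linear T"
  have "bounded_linear (\<lambda>x :: 'h. c *\<^sub>C x)"
  proof (rule bounded_linear_intro[where K = "cmod c"])
    show "c *\<^sub>C (r *\<^sub>R x) = r *\<^sub>R (c *\<^sub>C x)" for r and x :: 'h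
      by (simp add: scaleR_scaleC scaleC_scaleC mult.commute)
  qed (simp_all add: scaleC_add_right norm_scaleC mult.commute)
  from bounded_linear_compose[OF this T] show "bounded_linear (\<lambda>x. c *\<^sub>C T x)" .
qed

definition cadjoint :: "'h::complex_hilbert bop \<Rightarrow> 'h bop" where
  "cadjoint T = (THE S. \<forall>x y. cinner (blinfun_apply T x) y = cinner x (blinfun_apply S y))"

definition op_ball :: "('n::finite, 'h::complex_hilbert) optuple set" where
  "op_ball = {X. (\<forall>i. X i \<in> BH) \<and> sqrt (norm (\<Sum>i\<in>UNIV. X i o\<^sub>L cadjoint (X i))) < 1}"

primrec word_op :: "('n, 'h::complex_hilbert) optuple \<Rightarrow> 'n list \<Rightarrow> 'h bop" where
  "word_op X [] = id_blinfun"
| "word_op X (i # w) = X i o\<^sub>L word_op X w"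


section \<open>Free holomorphic functions\<close>

definition radius_condition :: "('n::finite list \<Rightarrow> complex) \<Rightarrow> bool" where
  "radius_condition a \<longleftrightarrow>
     limsup (\<lambda>k. ereal ((\<Sum>w | length w = k. (cmod (a w))\<^sup>2) powr (1 / (2 * real k)))) \<le> 1"

text \<open>
  A free holomorphic function only matters on \<open>op_ball\<close>; \<open>is_free_series a f\<close> constrains its
  values nowhere else.
\<close>

definition is_free_series ::
  "('n::finite list \<Rightarrow> complex) \<Rightarrow> (('n, 'h::complex_hilbert) optuple \<Rightarrow> 'h bop) \<Rightarrow> bool" where
  "is_free_series a f \<longleftrightarrow> radius_condition a \<and>
     (\<forall>X\<in>op_ball. (\<lambda>k. \<Sum>w | length w = k. scaleC_bop (a w) (word_op X w)) sums f X)"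

definition free_holomorphic ::
  "(('n::finite, 'h::complex_hilbert) optuple \<Rightarrow> 'h bop) \<Rightarrow> bool" where
  "free_holomorphic f \<longleftrightarrow> (\<exists>a. is_free_series a f)"

definition free_self_map ::
  "(('n::finite, 'h::complex_hilbert) optuple \<Rightarrow> ('n, 'h) optuple) \<Rightarrow> bool" where
  "free_self_map \<phi> \<longleftrightarrow> (\<forall>i. free_holomorphic (\<lambda>X. \<phi> X i)) \<and> (\<forall>X\<in>op_ball. \<phi> X \<in> op_ball)"

text \<open>
  Since \<open>'h\<close> is infinite dimensional where this is used, the coefficients of a free holomorphic
  function are unique.
\<close>

definition coeffs ::
  "(('n::finite, 'h::complex_hilbert) optuple \<Rightarrow> 'h bop) \<Rightarrow> 'n list \<Rightarrow> complex" where
  "coeffs f = (THE a. is_free_series a f)"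


section \<open>The Hardy space of the ball\<close>

text \<open>
  Functions on the ball are represented by total functions that vanish outside of it, so that
  equality in \<open>H2_ball\<close> is equality on the ball.
\<close>

definition H2_ball :: "(('n::finite, 'h::complex_hilbert) optuple \<Rightarrow> 'h bop) set" where
  "H2_ball = {f. free_holomorphic f \<and> (\<lambda>w. (cmod (coeffs f w))\<^sup>2) summable_on UNIV
                 \<and> (\<forall>X. X \<notin> op_ball \<longrightarrow> f X = 0)}"

definition H2_norm :: "(('n::finite, 'h::complex_hilbert) optuple \<Rightarrow> 'h bop) \<Rightarrow> real" where
  "H2_norm f = sqrt (\<Sum>\<^sub>\<infinity>w. (cmod (coeffs f w))\<^sup>2)"

definition H2_topology :: "(('n::finite, 'h::complex_hilbert) optuple \<Rightarrow> 'h bop) topology" where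
  "H2_topology = Metric_space.mtopology H2_ball (\<lambda>f g. H2_norm (\<lambda>X. f X - g X))"


section \<open>Composition operators\<close>

type_synonym ('n, 'h) H2_operator =
  "(('n, 'h) optuple \<Rightarrow> 'h bop) \<Rightarrow> (('n, 'h) optuple \<Rightarrow> 'h bop)"

text \<open>
  Operators on \<open>H2_ball\<close> are extensional functions on that set, so that equal operators are
  equal as HOL functions. Summing the series of \<open>f\<close> at the point \<open>\<phi> X\<close> of the ball is the same as
  summing \<open>\<Sum>a\<^sub>\<alpha> \<phi>\<^sub>\<alpha>(X)\<close>, because \<open>\<phi>\<^sub>\<alpha>(X)\<close> is \<open>word_op (\<phi> X) \<alpha>\<close>.
\<close>

definition comp_op ::
  "(('n::finite, 'h::complex_hilbert) optuple \<Rightarrow> ('n, 'h) optuple) \<Rightarrow> ('n, 'h) H2_operator" where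
  "comp_op \<phi> = (\<lambda>f\<in>H2_ball. \<lambda>X. if X \<in> op_ball then f (\<phi> X) else 0)"

definition composition_operators :: "('n::finite, 'h::complex_hilbert) H2_operator set" where
  "composition_operators = {comp_op \<phi> | \<phi>. free_self_map \<phi>}"

text \<open>
  The supremum is taken in \<open>ennreal\<close>. It is finite on differences of composition operators, as
  these are bounded; \<open>enn2real\<close> sends the value \<open>\<infinity>\<close> for other functions to \<open>0\<close>.
\<close>

definition op_norm :: "('n::finite, 'h::complex_hilbert) H2_operator \<Rightarrow> real" where
  "op_norm T = enn2real (SUP f\<in>{f\<in>H2_ball. H2_norm f \<le> 1}. ennreal (H2_norm (T f)))"

definition composition_operator_topology ::
  "('n::finite, 'h::complex_hilbert) H2_operator topology" where
  "composition_operator_topology =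
     Metric_space.mtopology composition_operators (\<lambda>S T. op_norm (\<lambda>f X. S f X - T f X))"

definition compact_operator :: "('n::finite, 'h::complex_hilbert) H2_operator \<Rightarrow> bool" where
  "compact_operator T \<longleftrightarrow> T \<in> H2_ball \<rightarrow> H2_ball \<and>
     compactin H2_topology (H2_topology closure_of (T ` {f\<in>H2_ball. H2_norm f \<le> 1}))"

end

(* Write D_t f (X) = f (t X). Then C_{t phi} = C_phi D_t, and D_t is the diagonal operator
   a_w |-> t^|w| a_w, a contraction of H^2 for 0 <= t <= 1. Hence t |-> C_{t phi} runs from the
   evaluation at the origin, which does not depend on phi, to C_phi. If C_phi is compact, so is
   every C_{t phi}, and the path is norm continuous: D_t depends on t strongly continuously, and
   composing with the compact C_phi turns this into norm continuity.

   The operator norm is a metric on composition operators only because all of them are bounded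
   (Littlewood subordination). The row (phi_1, ..., phi_n) acts contractively from n copies of the
   Fock space by left multiplication, as one sees by inserting truncated creation operators into
   phi. Peeling off the first letter of each word gives
   |f o phi|^2 <= |f(phi(0))|^2 + sum_i |f_i o phi|^2 for f = f(0) + sum_i X_i f_i. Iterated, the
   right-hand side becomes |G|^2 with G_w = f_w + sum_i lambda_i G_{wi} and lambda = phi(0), whence
   |f o phi| <= |f| / (1 - |lambda|). *)

theory Submission
  imports Defs
begin


section \<open>Adjoints and the operatorial ball\<close>

text \<open>An abstract \<open>'h\<close> carries no Fock space, but it contains finite pieces of
  one: an orthonormal family indexed by the words of length at most \<open>N\<close>. The compressed
  creation operators are nilpotent, so a free series evaluated at them is a finite sum and displays
  its coefficients up to powers of r; the factor r < 1 puts them strictly inside the ball, and r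
  tends to 1 afterwards. The contraction and subordination estimates are therefore proved for finite
  sums, with bounds independent of the truncations, and only then passed to \<open>l2\<close>. The
  constant 1 / (1 - |lambda|) arises because each nonempty word is \<open>w @ [i]\<close> for
  exactly one pair: by Cauchy-Schwarz the map sending G to the family sum_i lambda_i G_{wi} has norm
  at most |lambda| < 1, and its contribution is absorbed on the left. Continuity of the path cannot
  be inherited from D_t, since for fixed t < 1 the factor 1 - t^k is close to 1 for large k. What
  D_t does give is convergence at each point of the ball, uniformly over the unit ball of
  coefficients.\<close>

instance complex_hilbert \<subseteq> banach ..

lemma scaleC_one [simp]: "1 *\<^sub>C x = (x :: 'a::complex_inner)"
  using scaleR_scaleC[of 1 x] by simp

lemma scaleC_zero_left [simp]: "0 *\<^sub>C x = (0 :: 'a::complex_inner)"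
  using scaleR_scaleC[of 0 x] by simp

lemma scaleC_zero_right [simp]: "c *\<^sub>C 0 = (0 :: 'a::complex_inner)"
  using norm_scaleC[of c "0 :: 'a"] by simp

lemma scaleC_minus_left: "(- c) *\<^sub>C x = - (c *\<^sub>C x :: 'a::complex_inner)"
  using scaleC_add_left[of c "- c" x] by (simp add: eq_neg_iff_add_eq_0 add.commute)

lemma scaleC_sum_right: "c *\<^sub>C (\<Sum>i\<in>A. f i) = (\<Sum>i\<in>A. c *\<^sub>C f i :: 'a::complex_inner)"
  by (induction A rule: infinite_finite_induct) (simp_all add: scaleC_add_right)

lemma scaleC_sum_left: "(\<Sum>i\<in>A. f i) *\<^sub>C x = (\<Sum>i\<in>A. f i *\<^sub>C x :: 'a::complex_inner)"
  by (induction A rule: infinite_finite_induct) (simp_all add: scaleC_add_left)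

lemma scaleC_scaleR: "c *\<^sub>C (r *\<^sub>R x) = r *\<^sub>R (c *\<^sub>C x :: 'a::complex_inner)"
  by (simp add: scaleR_scaleC scaleC_scaleC mult.commute)

lemma cinner_zero_left [simp]: "cinner 0 (x :: 'a::complex_inner) = 0"
  using cinner_scaleC_left[of 0 0 x] by simp

lemma cinner_diff_left: "cinner (x - y) (z :: 'a::complex_inner) = cinner x z - cinner y z"
  using cinner_add_left[of "x - y" y z] by simp

lemma cinner_sum_left: "cinner (\<Sum>i\<in>A. f i) (x :: 'a::complex_inner) = (\<Sum>i\<in>A. cinner (f i) x)"
  by (induction A rule: infinite_finite_induct) (simp_all add: cinner_add_left)

lemma cinner_self: "cinner x x = complex_of_real ((norm (x :: 'a::complex_inner))\<^sup>2)"
proof (rule complex_eqI)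
  show "Im (cinner x x) = Im (complex_of_real ((norm x)\<^sup>2))"
    using cinner_commute[of x x] by (metis Reals_cnj_iff complex_is_Real_iff Im_complex_of_real)
qed (simp flip: inner_eq_Re_cinner add: power2_norm_eq_inner)

lemma norm_cinner_le: "cmod (cinner x y) \<le> norm x * norm (y :: 'a::complex_inner)"
proof (cases "cinner x y = 0")
  case False
  \<comment> \<open>A unimodular factor turning the complex inner product into its modulus, so that
    the real Cauchy-Schwarz inequality applies.\<close>
  define c where "c = cnj (cinner x y) / cmod (cinner x y)"
  have "cinner (c *\<^sub>C x) y = cmod (cinner x y)"
    using False by (simp add: cinner_scaleC_left c_def complex_norm_square[symmetric] power2_eq_square mult.commute)
  then have "cmod (cinner x y) = inner (c *\<^sub>C x) y"
    by (simp add: inner_eq_Re_cinner)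
  also have "\<dots> \<le> norm (c *\<^sub>C x) * norm y"
    by (rule norm_cauchy_schwarz)
  also have "norm (c *\<^sub>C x) = norm x"
    using False by (simp add: norm_scaleC c_def norm_divide)
  finally show ?thesis .
qed simp

text \<open>The representing vector minimises \<open>\<parallel>x\<parallel>\<^sup>2 / 2 - f x\<close>; by the parallelogram law every minimising
  sequence is Cauchy.\<close>

lemma riesz_representation:
  fixes f :: "'a::{real_inner,complete_space} \<Rightarrow> real"
  assumes "bounded_linear f"
  shows "\<exists>y. \<forall>x. f x = inner x y"
proof -
  have add: "f (x + y) = f x + f y" and scaleR: "f (r *\<^sub>R x) = r * f x" for x y r
    using assms by (simp_all add: linear_add linear_scale bounded_linear.linear)
  define g where "g x = (norm x)\<^sup>2 / 2 - f x" for x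
  obtain K where K: "\<And>x. norm (f x) \<le> norm x * K"
    using bounded_linear.bounded[OF assms] by blast
  have g_bdd: "- (K\<^sup>2 / 2) \<le> g x" for x
  proof -
    have "0 \<le> (norm x - K)\<^sup>2" by simp
    then have "norm x * K \<le> (norm x)\<^sup>2 / 2 + K\<^sup>2 / 2"
      by (simp add: power2_eq_square algebra_simps)
    with K[of x] show ?thesis by (simp add: g_def)
  qed
  define m where "m = (INF x. g x)"
  have bdd: "bdd_below (range g)"
    by (rule bdd_belowI2) (rule g_bdd)
  have m_le: "m \<le> g x" for x
    unfolding m_def by (rule cINF_lower[OF bdd]) simp
  have "\<exists>x. g x < m + 1 / real (Suc n)" for n
  proof -
    have "(INF x. g x) < m + 1 / real (Suc n)" by (simp add: m_def)
    then show ?thesis by (subst (asm) cINF_less_iff[OF _ bdd]) auto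
  qed
  then obtain x where x: "\<And>n. g (x n) < m + 1 / real (Suc n)" by metis
  have par: "(norm (u - v))\<^sup>2 \<le> 4 * (g u - m) + 4 * (g v - m)" for u v
  proof -
    have par1: "(norm (u - v))\<^sup>2 + (norm (u + v))\<^sup>2 = 2 * (norm u)\<^sup>2 + 2 * (norm v)\<^sup>2"
      by (simp add: power2_norm_eq_inner inner_add inner_diff algebra_simps)
    define w where "w = (1/2) *\<^sub>R (u + v)"
    have "g w = (norm (u + v))\<^sup>2 / 8 - f u / 2 - f v / 2"
      by (simp add: g_def w_def scaleR add power_mult_distrib power_divide add_divide_distrib del: scaleR_add_right)
    then have "8 * m \<le> 8 * ((norm (u + v))\<^sup>2 / 8 - f u / 2 - f v / 2)"
      using m_le[of w] by (metis mult_left_mono zero_le_numeral)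
    with par1 show ?thesis
      by (simp add: g_def algebra_simps)
  qed
  have "Cauchy x"
  proof (rule metric_CauchyI)
    fix e :: real assume "0 < e"
    then obtain M where M: "1 / real (Suc M) < e\<^sup>2 / 8"
      using reals_Archimedean[of "e\<^sup>2 / 8"] by (auto simp: inverse_eq_divide)
    show "\<exists>M. \<forall>i\<ge>M. \<forall>j\<ge>M. dist (x i) (x j) < e"
    proof (intro exI allI impI)
      fix i j assume ij: "M \<le> i" "M \<le> j"
      have le: "1 / real (Suc k) \<le> 1 / real (Suc M)" if "M \<le> k" for k
        using that by (simp add: frac_le)
      have "(norm (x i - x j))\<^sup>2 < e\<^sup>2"
        using par[of "x i" "x j"] x[of i] x[of j] le[OF ij(1)] le[OF ij(2)] M by argo
      then show "dist (x i) (x j) < e"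
        using \<open>0 < e\<close> by (simp add: dist_norm power2_less_imp_less)
    qed
  qed
  then obtain y where y: "x \<longlonglongrightarrow> y"
    using Cauchy_convergent convergent_def by blast
  have "(\<lambda>n. g (x n)) \<longlonglongrightarrow> g y"
    unfolding g_def by (intro tendsto_intros bounded_linear.tendsto[OF assms] y) simp
  moreover have "(\<lambda>n. m + 1 / real (Suc n)) \<longlonglongrightarrow> m + 0"
    by (intro tendsto_add tendsto_const LIMSEQ_Suc[OF lim_1_over_n])
  ultimately have "g y \<le> m + 0"
    by (rule LIMSEQ_le) (use x less_imp_le in blast)
  then have min: "g y \<le> g z" for z
    using m_le[of z] by simp
  have "f h = inner h y" for h
  proof -
    define c where "c = inner h y - f h"
    have q: "0 \<le> t * c + t\<^sup>2 * ((norm h)\<^sup>2 / 2)" for t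
    proof -
      have "(norm (y + t *\<^sub>R h))\<^sup>2 = (norm y)\<^sup>2 + 2 * t * inner h y + t\<^sup>2 * (norm h)\<^sup>2"
        unfolding power2_norm_eq_inner
        by (simp add: inner_add inner_commute[of y h] power2_eq_square[of t] algebra_simps)
      then show ?thesis using min[of "y + t *\<^sub>R h"]
        by (simp add: g_def c_def add scaleR algebra_simps)
    qed
    \<comment> \<open>The quadratic is evaluated at t = -c/s, where it equals -(c/s)^2. The summand
      1 keeps s positive when h = 0.\<close>
    define s where "s = (norm h)\<^sup>2 / 2 + 1"
    have s: "0 < s" "(norm h)\<^sup>2 / 2 = s - 1" by (simp_all add: s_def add_nonneg_pos)
    have "0 \<le> (- c / s) * c + (- c / s)\<^sup>2 * (s - 1)" using q[of "- c / s"] s(2) by simp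
    also have "\<dots> = - ((c / s)\<^sup>2)" using s(1)
      by (simp add: field_simps power2_eq_square)
    finally have "c = 0" using s(1) by simp
    then show ?thesis by (simp add: c_def)
  qed
  then show ?thesis by blast
qed

text \<open>Riesz representation gives an adjoint for the real inner product only. Complex linearity
  of \<open>T\<close> upgrades it, because the imaginary part of \<open>cinner u v\<close> is minus
  the real inner product of \<open>\<i> *\<^sub>C u\<close> with v. As \<open>cadjoint\<close> is a
  definite description, uniqueness has to be shown too.\<close>

lemma BH_adjoint:
  assumes "T \<in> BH"
  shows "cinner (blinfun_apply T x) y = cinner x (blinfun_apply (cadjoint T) y)"
proof -
  have "\<exists>z. \<forall>x. inner (blinfun_apply T x) y = inner x z" for y
    by (rule riesz_representation)
      (intro bounded_linear_compose[OF bounded_linear_inner_left] blinfun.bounded_linear_right)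
  then obtain S where S: "\<And>x y. inner (blinfun_apply T x) y = inner x (S y)" by metis
  have inner_eqI: "u = v" if "\<And>x. inner x u = inner x v" for u v :: 'a
    using that[of "u - v"] by (metis inner_diff_right inner_eq_zero_iff right_minus_eq)
  have "bounded_linear S"
  proof (rule bounded_linear_intro[where K = "norm T"])
    show "S (y + z) = S y + S z" for y z
      by (rule inner_eqI) (simp add: inner_add_right flip: S)
    show "S (r *\<^sub>R y) = r *\<^sub>R S y" for r y
      by (rule inner_eqI) (simp flip: S)
    show "norm (S y) \<le> norm y * norm T" for y
    proof -
      have "(norm (S y))\<^sup>2 = inner (blinfun_apply T (S y)) y"
        by (simp add: S power2_norm_eq_inner)
      also have "\<dots> \<le> norm (blinfun_apply T (S y)) * norm y"
        by (rule norm_cauchy_schwarz)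
      also have "\<dots> \<le> norm T * norm (S y) * norm y"
        by (intro mult_right_mono norm_blinfun) simp
      finally show ?thesis
        by (cases "S y = 0") (auto simp: power2_eq_square mult.commute mult.left_commute)
    qed
  qed
  then have app: "blinfun_apply (Blinfun S) = S" by (rule bounded_linear_Blinfun_apply)
  have Im: "Im (cinner u v) = - inner (\<i> *\<^sub>C u) v" for u v :: 'a
    by (simp add: inner_eq_Re_cinner cinner_scaleC_left)
  have "cinner (blinfun_apply T x) y = cinner x (S y)" for x y
  proof (rule complex_eqI)
    show "Im (cinner (blinfun_apply T x) y) = Im (cinner x (S y))"
      using assms by (simp add: Im BH_def flip: S)
  qed (simp add: S flip: inner_eq_Re_cinner)
  then have ex: "\<forall>x y. cinner (blinfun_apply T x) y = cinner x (blinfun_apply (Blinfun S) y)"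
    by (simp add: app)
  have "\<forall>x y. cinner (blinfun_apply T x) y = cinner x (blinfun_apply (cadjoint T) y)"
    unfolding cadjoint_def
  proof (rule theI[of _ "Blinfun S"])
    fix S' assume S': "\<forall>x y. cinner (blinfun_apply T x) y = cinner x (blinfun_apply S' y)"
    show "S' = Blinfun S"
      by (rule blinfun_eqI, rule inner_eqI) (metis S' ex inner_eq_Re_cinner)
  qed (rule ex)
  then show ?thesis by blast
qed

lemma inner_adjoint:
  "T \<in> BH \<Longrightarrow> inner (blinfun_apply T x) y = inner x (blinfun_apply (cadjoint T) y)"
  by (simp add: BH_adjoint inner_eq_Re_cinner)

text \<open>A norm bound for the row operator (X_1, ..., X_n) from n copies of \<open>'h\<close> to
  \<open>'h\<close>, written with squares so that the direct sum needs no Hilbert space structure of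
  its own.\<close>

definition row_bounded :: "('n::finite, 'h::complex_hilbert) optuple \<Rightarrow> real \<Rightarrow> bool" where
  "row_bounded X \<rho> \<longleftrightarrow>
     (\<forall>v. (norm (\<Sum>i\<in>UNIV. blinfun_apply (X i) (v i)))\<^sup>2 \<le> \<rho>\<^sup>2 * (\<Sum>i\<in>UNIV. (norm (v i))\<^sup>2))"

text \<open>If X is the row operator and P = X X^*, then \<open>inner (blinfun_apply P y) y\<close>
  is the sum of the |X_i^* y|^2, and the norm of P is the square of that of X. Adjoints disappear
  from the argument after this.\<close>

lemma op_ball_iff:
  fixes X :: "('n::finite, 'h::complex_hilbert) optuple"
  shows "X \<in> op_ball \<longleftrightarrow> (\<forall>i. X i \<in> BH) \<and> (\<exists>\<rho>. 0 \<le> \<rho> \<and> \<rho> < 1 \<and> row_bounded X \<rho>)"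
proof (cases "\<forall>i. X i \<in> BH")
  case BH: True
  define P where "P = (\<Sum>i\<in>UNIV. X i o\<^sub>L cadjoint (X i))"
  have P_app: "blinfun_apply P y = (\<Sum>i\<in>UNIV. blinfun_apply (X i) (blinfun_apply (cadjoint (X i)) y))" for y
    by (simp add: P_def blinfun.sum_left)
  have P_inner: "inner (blinfun_apply P y) y = (\<Sum>i\<in>UNIV. (norm (blinfun_apply (cadjoint (X i)) y))\<^sup>2)" for y
    using BH by (simp add: P_app inner_sum_left inner_adjoint power2_norm_eq_inner)
  have "norm P < 1 \<longleftrightarrow> (\<exists>\<rho>. 0 \<le> \<rho> \<and> \<rho> < 1 \<and> row_bounded X \<rho>)"
  proof
    assume "norm P < 1"
    have "row_bounded X (sqrt (norm P))"
      unfolding row_bounded_def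
    proof
      fix v :: "'n \<Rightarrow> 'h"
      define z where "z = (\<Sum>i\<in>UNIV. blinfun_apply (X i) (v i))"
      define s where "s = (\<Sum>i\<in>UNIV. (norm (v i))\<^sup>2)"
      have "(norm z)\<^sup>2 = (\<Sum>i\<in>UNIV. inner (v i) (blinfun_apply (cadjoint (X i)) z))"
        using BH by (simp add: power2_norm_eq_inner inner_sum_left inner_adjoint z_def)
      also have "\<dots> \<le> (\<Sum>i\<in>UNIV. \<bar>norm (v i)\<bar> * \<bar>norm (blinfun_apply (cadjoint (X i)) z)\<bar>)"
        by (intro sum_mono) (simp add: norm_cauchy_schwarz)
      also have "\<dots> \<le> L2_set (\<lambda>i. norm (v i)) UNIV * L2_set (\<lambda>i. norm (blinfun_apply (cadjoint (X i)) z)) UNIV"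
        by (rule L2_set_mult_ineq)
      finally have "((norm z)\<^sup>2)\<^sup>2 \<le> (L2_set (\<lambda>i. norm (v i)) UNIV * L2_set (\<lambda>i. norm (blinfun_apply (cadjoint (X i)) z)) UNIV)\<^sup>2"
        by (rule power_mono) simp
      also have "\<dots> = s * inner (blinfun_apply P z) z"
        by (simp add: L2_set_def power_mult_distrib real_sqrt_pow2 sum_nonneg s_def P_inner)
      also have "\<dots> \<le> s * (norm P * (norm z)\<^sup>2)"
      proof (rule mult_left_mono)
        have "inner (blinfun_apply P z) z \<le> norm (blinfun_apply P z) * norm z"
          by (rule norm_cauchy_schwarz)
        also have "\<dots> \<le> norm P * norm z * norm z"
          by (intro mult_right_mono norm_blinfun) simp
        finally show "inner (blinfun_apply P z) z \<le> norm P * (norm z)\<^sup>2"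
          by (simp add: power2_eq_square mult.assoc)
      qed (simp add: s_def sum_nonneg)
      finally have le: "(norm z)\<^sup>2 * (norm z)\<^sup>2 \<le> (norm P * s) * (norm z)\<^sup>2"
        by (simp add: power2_eq_square[of "(norm z)\<^sup>2"] ac_simps)
      have "0 \<le> norm P * s" by (simp add: s_def sum_nonneg)
      with le have "(norm z)\<^sup>2 \<le> norm P * s"
        by (cases "z = 0") (simp, metis mult_le_cancel_right_pos zero_less_norm_iff zero_less_power)
      then show "(norm (\<Sum>i\<in>UNIV. blinfun_apply (X i) (v i)))\<^sup>2
          \<le> (sqrt (norm P))\<^sup>2 * (\<Sum>i\<in>UNIV. (norm (v i))\<^sup>2)"
        by (simp add: z_def s_def)
    qed
    moreover have "0 \<le> sqrt (norm P)" "sqrt (norm P) < 1"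
      using \<open>norm P < 1\<close> by simp_all
    ultimately show "\<exists>\<rho>. 0 \<le> \<rho> \<and> \<rho> < 1 \<and> row_bounded X \<rho>" by blast
  next
    assume "\<exists>\<rho>. 0 \<le> \<rho> \<and> \<rho> < 1 \<and> row_bounded X \<rho>"
    then obtain \<rho> where \<rho>: "0 \<le> \<rho>" "\<rho> < 1" "row_bounded X \<rho>" by blast
    have "norm P \<le> \<rho>"
    proof (rule norm_blinfun_bound[OF \<rho>(1)])
      fix y
      define s where "s = inner (blinfun_apply P y) y"
      have sq: "(norm (blinfun_apply P y))\<^sup>2 \<le> \<rho>\<^sup>2 * s"
        unfolding s_def P_inner unfolding P_app by (rule \<rho>(3)[unfolded row_bounded_def, rule_format])
      have "s \<le> norm (blinfun_apply P y) * norm y"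
        unfolding s_def by (rule norm_cauchy_schwarz)
      with sq have "(norm (blinfun_apply P y))\<^sup>2 \<le> \<rho>\<^sup>2 * (norm (blinfun_apply P y) * norm y)"
        by (meson mult_left_mono order_trans zero_le_power2)
      then have "norm (blinfun_apply P y) \<le> \<rho>\<^sup>2 * norm y"
        by (cases "blinfun_apply P y = 0")
          (simp_all add: power2_eq_square[of "norm (blinfun_apply P y)"] ac_simps)
      \<comment> \<open>The sharp bound is \<rho>^2; the weaker \<rho> suffices for a strict
        inequality with 1.\<close>
      also have "\<dots> \<le> \<rho> * norm y"
        using \<rho>(1,2) by (intro mult_right_mono) (simp_all add: power2_eq_square mult_left_le)
      finally show "norm (blinfun_apply P y) \<le> \<rho> * norm y" .
    qed
    then show "norm P < 1" using \<rho>(2) by simp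
  qed
  then show ?thesis
    using BH by (simp add: op_ball_def P_def)
next
  case False
  then show ?thesis unfolding op_ball_def by blast
qed


section \<open>Truncated shifts\<close>

definition orthonormal_on :: "('w \<Rightarrow> 'h::complex_inner) \<Rightarrow> 'w set \<Rightarrow> bool" where
  "orthonormal_on e A \<longleftrightarrow> (\<forall>u\<in>A. \<forall>v\<in>A. cinner (e u) (e v) = (if u = v then 1 else 0))"

lemma orthonormal_onD:
  "orthonormal_on e A \<Longrightarrow> u \<in> A \<Longrightarrow> v \<in> A \<Longrightarrow> cinner (e u) (e v) = (if u = v then 1 else 0)"
  by (simp add: orthonormal_on_def)

lemma cinner_sum_orthonormal:
  assumes "finite A" "orthonormal_on e A" "v \<in> A"
  shows "cinner (\<Sum>u\<in>A. c u *\<^sub>C e u) (e v) = c v"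
proof -
  have "cinner (\<Sum>u\<in>A. c u *\<^sub>C e u) (e v) = (\<Sum>u\<in>A. if u = v then c v else 0)"
    unfolding cinner_sum_left
    by (rule sum.cong) (use assms in \<open>auto simp: cinner_scaleC_left orthonormal_onD\<close>)
  then show ?thesis using assms by simp
qed

lemma norm_sum_orthonormal:
  assumes "finite A" "orthonormal_on e A"
  shows "(norm (\<Sum>u\<in>A. c u *\<^sub>C e u))\<^sup>2 = (\<Sum>u\<in>A. (cmod (c u))\<^sup>2)"
proof -
  let ?s = "\<Sum>u\<in>A. c u *\<^sub>C e u"
  have "cinner ?s ?s = (\<Sum>u\<in>A. c u * cinner (e u) ?s)"
    by (subst cinner_sum_left) (simp add: cinner_scaleC_left)
  also have "\<dots> = (\<Sum>u\<in>A. c u * cnj (c u))"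
    by (rule sum.cong) (use cinner_sum_orthonormal[OF assms] cinner_commute in metis)+
  also have "\<dots> = complex_of_real (\<Sum>u\<in>A. (cmod (c u))\<^sup>2)"
    by (simp add: complex_norm_square del: of_real_power)
  finally show ?thesis
    unfolding cinner_self of_real_eq_iff .
qed

lemma bessel_inequality:
  assumes "finite A" "orthonormal_on e A"
  shows "(\<Sum>u\<in>A. (cmod (cinner v (e u)))\<^sup>2) \<le> (norm v)\<^sup>2"
proof -
  let ?s = "\<Sum>u\<in>A. cinner v (e u) *\<^sub>C e u"
  have "cinner ?s v = (\<Sum>u\<in>A. cinner v (e u) * cnj (cinner v (e u)))"
    unfolding cinner_sum_left cinner_scaleC_left by (metis cinner_commute)
  also have "\<dots> = complex_of_real (\<Sum>u\<in>A. (cmod (cinner v (e u)))\<^sup>2)"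
    by (simp add: complex_norm_square del: of_real_power)
  finally have "inner ?s v = (norm ?s)\<^sup>2"
    unfolding inner_eq_Re_cinner norm_sum_orthonormal[OF assms] by simp
  moreover have "inner ?s v \<le> norm ?s * norm v" by (rule norm_cauchy_schwarz)
  ultimately have "norm ?s \<le> norm v"
    by (cases "?s = 0") (auto simp: power2_eq_square)
  then show ?thesis
    unfolding norm_sum_orthonormal[OF assms, symmetric] by (simp add: power_mono)
qed

text \<open>Gram-Schmidt: the component of a vector orthogonal to the finite span is normalised.
  Infinite dimension enters here, and later arguments use it only through such families.\<close>

lemma ex_orthonormal_on:
  assumes inf: "infinite_dimensional TYPE('h::complex_hilbert)" and "finite A"
  shows "\<exists>e :: 'w \<Rightarrow> 'h. orthonormal_on e A"
  using \<open>finite A\<close>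
proof induction
  case empty
  then show ?case by (simp add: orthonormal_on_def)
next
  case (insert a A)
  then obtain e :: "'w \<Rightarrow> 'h" where e: "orthonormal_on e A" by blast
  interpret vector_space "scaleC :: complex \<Rightarrow> 'h \<Rightarrow> 'h" by (rule vector_space_scaleC)
  have "span (e ` A) \<noteq> UNIV"
    using inf insert.hyps by (auto simp: infinite_dimensional_def)
  then obtain x where x: "x \<notin> span (e ` A)" by blast
  define y where "y = x - (\<Sum>u\<in>A. cinner x (e u) *\<^sub>C e u)"
  have "y \<noteq> 0"
  proof
    assume "y = 0"
    then have "x = (\<Sum>u\<in>A. cinner x (e u) *\<^sub>C e u)" by (simp add: y_def)
    also have "\<dots> \<in> span (e ` A)" by (intro span_sum span_scale span_base) simp
    finally show False using x by simp
  qed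
  define z where "z = complex_of_real (1 / norm y) *\<^sub>C y"
  have y_orth: "cinner y (e v) = 0" if "v \<in> A" for v
    using cinner_sum_orthonormal[OF insert.hyps(1) e that] by (simp add: y_def cinner_diff_left)
  have left: "cinner z (e v) = 0" if "v \<in> A" for v
    using y_orth[OF that] by (simp add: z_def cinner_scaleC_left)
  have right: "cinner (e v) z = 0" if "v \<in> A" for v
    using left[OF that] by (metis cinner_commute complex_cnj_zero)
  have "cinner z z = 1"
    using \<open>y \<noteq> 0\<close> by (simp add: cinner_self z_def norm_scaleC norm_divide)
  then have "orthonormal_on (e(a := z)) (insert a A)"
    using e left right insert.hyps(2) by (auto simp: orthonormal_on_def)
  then show ?case by blast
qed

section \<open>Sums over words by length\<close>

lemma finite_words_le [simp]: "finite {w :: 'n::finite list. length w \<le> N}"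
  using finite_lists_length_le[of "UNIV :: 'n set" N] by simp

lemma finite_words_less [simp]: "finite {w :: 'n::finite list. length w < N}"
  by (rule finite_subset[OF _ finite_words_le[of N]]) auto

lemma finite_words_eq [simp]: "finite {w :: 'n::finite list. length w = N}"
  by (rule finite_subset[OF _ finite_words_le[of N]]) auto

lemma words_Suc: "{w. length w = Suc N} = (\<lambda>(i, u). i # u) ` (UNIV \<times> {u. length u = N})"
  by (auto simp: length_Suc_conv image_iff)

lemma sum_words_Suc:
  fixes g :: "'n::finite list \<Rightarrow> 'b::comm_monoid_add"
  shows "(\<Sum>w | length w = Suc N. g w) = (\<Sum>i\<in>UNIV. \<Sum>u | length u = N. g (i # u))"
  unfolding words_Suc
  by (subst sum.reindex) (auto simp: inj_on_def sum.cartesian_product case_prod_beta)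

lemma words_le_Suc:
  "{w. length w \<le> Suc N} = insert [] ((\<lambda>(i, u). i # u) ` (UNIV \<times> {u. length u \<le> N}))"
proof -
  have "w \<in> insert [] ((\<lambda>(i, u). i # u) ` (UNIV \<times> {u. length u \<le> N}))"
    if "length w \<le> Suc N" for w :: "'a list"
    using that by (cases w) (auto simp: image_iff)
  then show ?thesis by auto
qed

lemma sum_words_le_Suc:
  fixes g :: "'n::finite list \<Rightarrow> 'b::comm_monoid_add"
  shows "(\<Sum>w | length w \<le> Suc N. g w) = g [] + (\<Sum>i\<in>UNIV. \<Sum>u | length u \<le> N. g (i # u))"
proof -
  have "(\<Sum>w\<in>(\<lambda>(i, u). i # u) ` (UNIV \<times> {u. length u \<le> N}). g w) = (\<Sum>i\<in>UNIV. \<Sum>u | length u \<le> N. g (i # u))"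
    by (subst sum.reindex) (auto simp: inj_on_def sum.cartesian_product case_prod_beta)
  then show ?thesis
    unfolding words_le_Suc by (subst sum.insert) auto
qed

lemma sum_words_le:
  fixes g :: "'n::finite list \<Rightarrow> 'b::comm_monoid_add"
  shows "(\<Sum>w | length w \<le> N. g w) = (\<Sum>k\<le>N. \<Sum>w | length w = k. g w)"
proof (induction N)
  case (Suc N)
  have "{w :: 'n list. length w \<le> Suc N} = {w. length w \<le> N} \<union> {w. length w = Suc N}" by auto
  then have "(\<Sum>w | length w \<le> Suc N. g w) = (\<Sum>w | length w \<le> N. g w) + (\<Sum>w | length w = Suc N. g w)"
    by (simp only:) (rule sum.union_disjoint, auto)
  then show ?case using Suc.IH by simp
qed simp

section \<open>Free series at truncated creation operators\<close>

definition homogeneous_part ::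
  "('n::finite list \<Rightarrow> complex) \<Rightarrow> nat \<Rightarrow> ('n, 'h::complex_hilbert) optuple \<Rightarrow> 'h bop" where
  "homogeneous_part a k X = (\<Sum>w | length w = k. scaleC_bop (a w) (word_op X w))"

lemma homogeneous_part_apply:
  "blinfun_apply (homogeneous_part a k X) v = (\<Sum>w | length w = k. a w *\<^sub>C blinfun_apply (word_op X w) v)"
  by (simp add: homogeneous_part_def blinfun.sum_left scaleC_bop.rep_eq)

lemma is_free_series_iff:
  "is_free_series a f \<longleftrightarrow> radius_condition a \<and> (\<forall>X\<in>op_ball. (\<lambda>k. homogeneous_part a k X) sums f X)"
  by (simp add: is_free_series_def homogeneous_part_def)

text \<open>The left creation operators of the full Fock space, scaled by \<open>r\<close> and compressed to words of
  length at most \<open>N\<close>, transported to \<open>'h\<close> along an orthonormal family.\<close>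

definition trunc_shift ::
  "real \<Rightarrow> nat \<Rightarrow> ('n list \<Rightarrow> 'h::complex_hilbert) \<Rightarrow> ('n, 'h) optuple" where
  "trunc_shift r N e i =
     Blinfun (\<lambda>v. \<Sum>u | length u < N. (complex_of_real r * cinner v (e u)) *\<^sub>C e (i # u))"

lemma trunc_shift_apply:
  "blinfun_apply (trunc_shift r N e i) v
     = (\<Sum>u | length u < N. (complex_of_real r * cinner v (e u)) *\<^sub>C e (i # u))"
proof -
  have "bounded_linear (\<lambda>v. (complex_of_real r * cinner v y) *\<^sub>C z)" for y z :: 'a
  proof (rule bounded_linear_intro[where K = "\<bar>r\<bar> * norm y * norm z"])
    show "norm ((complex_of_real r * cinner v y) *\<^sub>C z) \<le> norm v * (\<bar>r\<bar> * norm y * norm z)" for v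
    proof -
      have "cmod (cinner v y) * (\<bar>r\<bar> * norm z) \<le> norm v * norm y * (\<bar>r\<bar> * norm z)"
        by (intro mult_right_mono norm_cinner_le) simp
      then show ?thesis by (simp add: norm_scaleC norm_mult mult_ac)
    qed
  qed (simp_all add: cinner_add_left scaleC_add_left ring_distribs scaleR_scaleC scaleC_scaleC
        cinner_scaleC_left mult_ac)
  then have "bounded_linear (\<lambda>v. \<Sum>u | length u < N. (complex_of_real r * cinner v (e u)) *\<^sub>C e (i # u))"
    by (intro bounded_linear_sum) blast
  then show ?thesis unfolding trunc_shift_def by (simp add: bounded_linear_Blinfun_apply)
qed

text \<open>The vectors \<open>e (i # u)\<close> are orthonormal over all pairs (i, u), so the n
  operators have mutually orthogonal ranges and Bessel's inequality bounds the row by r. The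
  restriction \<open>length u < N\<close> keeps \<open>i # u\<close> inside the orthonormal
  family.\<close>

lemma trunc_shift_in_op_ball:
  fixes e :: "'n::finite list \<Rightarrow> 'h::complex_hilbert"
  assumes e: "orthonormal_on e {w. length w \<le> N}" and r: "0 \<le> r" "r < 1"
  shows "trunc_shift r N e \<in> op_ball"
proof -
  have "trunc_shift r N e i \<in> BH" for i
    by (simp add: BH_def trunc_shift_apply cinner_scaleC_left scaleC_sum_right scaleC_scaleC mult_ac)
  moreover have "row_bounded (trunc_shift r N e) r"
    unfolding row_bounded_def
  proof
    fix v :: "'n \<Rightarrow> 'h"
    let ?L = "{u :: 'n list. length u < N}"
    have L: "orthonormal_on e ?L" "orthonormal_on (\<lambda>(i, u). e (i # u)) (UNIV \<times> ?L)"
      using e by (auto simp: orthonormal_on_def)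
    have "(\<Sum>i\<in>UNIV. blinfun_apply (trunc_shift r N e i) (v i))
        = (\<Sum>p\<in>UNIV \<times> ?L. (complex_of_real r * cinner (v (fst p)) (e (snd p))) *\<^sub>C (\<lambda>(i, u). e (i # u)) p)"
      by (simp add: trunc_shift_apply sum.cartesian_product case_prod_beta)
    then have "(norm (\<Sum>i\<in>UNIV. blinfun_apply (trunc_shift r N e i) (v i)))\<^sup>2
        = (\<Sum>p\<in>UNIV \<times> ?L. (cmod (complex_of_real r * cinner (v (fst p)) (e (snd p))))\<^sup>2)"
      using norm_sum_orthonormal[OF _ L(2)] by simp
    also have "\<dots> = r\<^sup>2 * (\<Sum>i\<in>UNIV. \<Sum>u\<in>?L. (cmod (cinner (v i) (e u)))\<^sup>2)"
      by (simp add: norm_mult power_mult_distrib sum_distrib_left sum.cartesian_product case_prod_beta)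
    also have "\<dots> \<le> r\<^sup>2 * (\<Sum>i\<in>UNIV. (norm (v i))\<^sup>2)"
      by (intro mult_left_mono sum_mono bessel_inequality L(1)) auto
    finally show "(norm (\<Sum>i\<in>UNIV. blinfun_apply (trunc_shift r N e i) (v i)))\<^sup>2
        \<le> r\<^sup>2 * (\<Sum>i\<in>UNIV. (norm (v i))\<^sup>2)" .
  qed
  ultimately show ?thesis using r unfolding op_ball_iff by blast
qed

text \<open>Words that would leave the truncation are sent to 0. This nilpotency makes free series
  finite at this point of the ball.\<close>

lemma word_op_trunc_shift:
  fixes e :: "'n::finite list \<Rightarrow> 'h::complex_hilbert"
  assumes e: "orthonormal_on e {w. length w \<le> N}" and u: "length u \<le> N"
  shows "blinfun_apply (word_op (trunc_shift r N e) w) (e u)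
     = (if length w + length u \<le> N then complex_of_real (r ^ length w) *\<^sub>C e (w @ u) else 0)"
proof (induction w)
  case Nil
  then show ?case using u by simp
next
  case (Cons i w)
  have step: "blinfun_apply (trunc_shift r N e i) (e x)
      = (if length x < N then complex_of_real r *\<^sub>C e (i # x) else 0)" if "length x \<le> N" for x
  proof -
    have "blinfun_apply (trunc_shift r N e i) (e x)
        = (\<Sum>y | length y < N. if y = x then complex_of_real r *\<^sub>C e (i # x) else 0)"
      unfolding trunc_shift_apply
      by (rule sum.cong) (use that e in \<open>auto simp: orthonormal_on_def\<close>)
    then show ?thesis by simp
  qed
  have scale: "blinfun_apply (trunc_shift r N e i) (c *\<^sub>C v) = c *\<^sub>C blinfun_apply (trunc_shift r N e i) v" for c v
    by (simp add: trunc_shift_apply cinner_scaleC_left scaleC_sum_right scaleC_scaleC mult_ac)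
  show ?case using Cons.IH step[of "w @ u"] by (simp add: scale scaleC_scaleC mult.commute)
qed

lemma free_series_trunc_shift:
  fixes e :: "'n::finite list \<Rightarrow> 'h::complex_hilbert"
  assumes e: "orthonormal_on e {w. length w \<le> N}" and r: "0 \<le> r" "r < 1"
    and f: "is_free_series b f" and u: "length u \<le> N"
  shows "blinfun_apply (f (trunc_shift r N e)) (e u)
     = (\<Sum>w | length w + length u \<le> N. (b w * complex_of_real (r ^ length w)) *\<^sub>C e (w @ u))"
proof -
  let ?X = "trunc_shift r N e"
  let ?h = "\<lambda>k. blinfun_apply (homogeneous_part b k ?X) (e u)"
  have "?h sums blinfun_apply (f ?X) (e u)"
    using f trunc_shift_in_op_ball[OF e r] unfolding is_free_series_iff
    by (intro bounded_linear.sums[OF blinfun.bounded_linear_left]) blast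
  moreover have "?h sums (\<Sum>k\<le>N - length u. ?h k)"
  proof (rule sums_finite)
    fix k assume "k \<notin> {..N - length u}"
    then show "?h k = 0"
      unfolding homogeneous_part_apply word_op_trunc_shift[OF e u] by (intro sum.neutral) auto
  qed simp
  ultimately have "blinfun_apply (f ?X) (e u) = (\<Sum>k\<le>N - length u. ?h k)"
    by (rule sums_unique2)
  also have "\<dots> = (\<Sum>k\<le>N - length u. \<Sum>w | length w = k. (b w * complex_of_real (r ^ length w)) *\<^sub>C e (w @ u))"
    unfolding homogeneous_part_apply word_op_trunc_shift[OF e u]
    by (intro sum.cong refl) (use u in \<open>auto simp: scaleC_scaleC\<close>)
  also have "\<dots> = (\<Sum>w | length w \<le> N - length u. (b w * complex_of_real (r ^ length w)) *\<^sub>C e (w @ u))"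
    by (rule sum_words_le[symmetric])
  also have "{w :: 'n list. length w \<le> N - length u} = {w. length w + length u \<le> N}"
    using u by auto
  finally show ?thesis .
qed

text \<open>At a truncated shift the vacuum vector \<open>e []\<close> is mapped to an orthogonal
  expansion whose component along \<open>e w\<close> is the coefficient at w times r^|w|. Any r
  strictly between 0 and 1 would do; the truncation only has to reach the length of w.\<close>

lemma free_series_unique:
  fixes f :: "('n::finite, 'h::complex_hilbert) optuple \<Rightarrow> 'h bop"
  assumes inf: "infinite_dimensional TYPE('h)" and "is_free_series a f" "is_free_series b f"
  shows "a = b"
proof
  fix w :: "'n list"
  obtain e :: "'n list \<Rightarrow> 'h" where e: "orthonormal_on e {v. length v \<le> length w}"
    using ex_orthonormal_on[OF inf finite_words_le] by blast
  have "c w * complex_of_real ((1 / 2) ^ length w)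
      = cinner (blinfun_apply (f (trunc_shift (1 / 2) (length w) e)) (e [])) (e w)"
    if "is_free_series c f" for c
    using free_series_trunc_shift[OF e _ _ that, of "1 / 2" "[]"]
      cinner_sum_orthonormal[OF finite_words_le e, of w "\<lambda>v. c v * complex_of_real ((1 / 2) ^ length v)"]
    by simp
  from trans[OF this[OF assms(2)] this[OF assms(3), symmetric]] show "a w = b w"
    by simp
qed

lemma coeffs_eq:
  fixes f :: "('n::finite, 'h::complex_hilbert) optuple \<Rightarrow> 'h bop"
  assumes "infinite_dimensional TYPE('h)" "is_free_series a f"
  shows "coeffs f = a"
  unfolding coeffs_def using assms free_series_unique by blast

text \<open>The coefficients of a product of free series: noncommuting monomials multiply by
  concatenation, so each splitting of x into prefix and suffix contributes once. On the Fock space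
  \<open>conv b\<close> is left multiplication by b.\<close>

definition conv ::
  "('n list \<Rightarrow> complex) \<Rightarrow> ('n list \<Rightarrow> complex) \<Rightarrow> 'n list \<Rightarrow> complex" where
  "conv b g x = (\<Sum>j\<le>length x. b (take j x) * g (drop j x))"

lemma sum_conv:
  fixes F :: "'n::finite list \<Rightarrow> 'h::complex_inner"
  shows "(\<Sum>u | length u \<le> N. \<Sum>w | length w + length u \<le> N. (b w * g u) *\<^sub>C F (w @ u))
     = (\<Sum>x | length x \<le> N. conv b g x *\<^sub>C F x)"
proof -
  have fin: "finite {w :: 'n list. length w + k \<le> N}" for k
    by (rule finite_subset[OF _ finite_words_le[of N]]) auto
  have "(\<Sum>u | length u \<le> N. \<Sum>w | length w + length u \<le> N. (b w * g u) *\<^sub>C F (w @ u))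
     = (\<Sum>(u, w)\<in>Sigma {u. length u \<le> N} (\<lambda>u. {w. length w + length u \<le> N}). (b w * g u) *\<^sub>C F (w @ u))"
    by (rule sum.Sigma) (use fin in auto)
  also have "\<dots> = (\<Sum>(x, j)\<in>Sigma {x. length x \<le> N} (\<lambda>x. {..length x}). (b (take j x) * g (drop j x)) *\<^sub>C F x)"
    by (rule sum.reindex_bij_witness[of _ "\<lambda>(x, j). (drop j x, take j x)" "\<lambda>(u, w). (w @ u, length w)"]) auto
  also have "\<dots> = (\<Sum>x | length x \<le> N. \<Sum>j\<le>length x. (b (take j x) * g (drop j x)) *\<^sub>C F x)"
    by (rule sum.Sigma[symmetric]) auto
  finally show ?thesis by (simp add: conv_def scaleC_sum_left)
qed

lemma BH_sum:
  "T \<in> BH \<Longrightarrow> blinfun_apply T (\<Sum>u\<in>A. c u *\<^sub>C x u) = (\<Sum>u\<in>A. c u *\<^sub>C blinfun_apply T (x u))"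
  by (simp add: blinfun.sum_right BH_def)

text \<open>The value of \<phi> at a truncated shift is again in the ball, hence a row contraction.
  Applied to the vectors with coordinates \<open>g i\<close>, it gives the vector whose coordinates
  are the sums of the convolutions, up to factors r^|w|. Truncation does no harm: coefficients of a
  product at words of length at most N involve only such coefficients of the factors.\<close>

lemma self_map_contraction:
  fixes \<phi> :: "('n::finite, 'h::complex_hilbert) optuple \<Rightarrow> ('n, 'h) optuple"
  assumes inf: "infinite_dimensional TYPE('h)"
    and ball: "\<And>X. X \<in> op_ball \<Longrightarrow> \<phi> X \<in> op_ball"
    and b: "\<And>i. is_free_series (b i) (\<lambda>X. \<phi> X i)"
  shows "(\<Sum>x | length x \<le> N. (cmod (\<Sum>i\<in>UNIV. conv (b i) (g i) x))\<^sup>2)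
      \<le> (\<Sum>i\<in>UNIV. \<Sum>u | length u \<le> N. (cmod (g i u))\<^sup>2)"
proof -
  obtain e :: "'n list \<Rightarrow> 'h" where e: "orthonormal_on e {v. length v \<le> N}"
    using ex_orthonormal_on[OF inf finite_words_le] by blast
  let ?b = "\<lambda>r i w. b i w * complex_of_real (r ^ length w)"
  have le: "(\<Sum>x | length x \<le> N. (cmod (\<Sum>i\<in>UNIV. conv (?b r i) (g i) x))\<^sup>2)
      \<le> (\<Sum>i\<in>UNIV. \<Sum>u | length u \<le> N. (cmod (g i u))\<^sup>2)" if r: "0 \<le> r" "r < 1" for r
  proof -
    define Y where "Y = \<phi> (trunc_shift r N e)"
    have "Y \<in> op_ball" using ball trunc_shift_in_op_ball[OF e r] by (simp add: Y_def)
    then obtain \<rho> where BH: "\<And>i. Y i \<in> BH" and \<rho>: "0 \<le> \<rho>" "\<rho> < 1" "row_bounded Y \<rho>"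
      unfolding op_ball_iff by blast
    let ?v = "\<lambda>i. \<Sum>u | length u \<le> N. g i u *\<^sub>C e u"
    have "blinfun_apply (Y i) (?v i) = (\<Sum>x | length x \<le> N. conv (?b r i) (g i) x *\<^sub>C e x)" for i
    proof -
      have "blinfun_apply (Y i) (?v i)
          = (\<Sum>u | length u \<le> N. \<Sum>w | length w + length u \<le> N. (?b r i w * g i u) *\<^sub>C e (w @ u))"
        unfolding BH_sum[OF BH] unfolding Y_def
        by (rule sum.cong[OF refl], subst free_series_trunc_shift[OF e r b])
          (simp_all add: scaleC_sum_right scaleC_scaleC mult_ac)
      also have "\<dots> = (\<Sum>x | length x \<le> N. conv (?b r i) (g i) x *\<^sub>C e x)"
        by (rule sum_conv)
      finally show ?thesis .
    qed
    then have "(\<Sum>i\<in>UNIV. blinfun_apply (Y i) (?v i))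
        = (\<Sum>x | length x \<le> N. (\<Sum>i\<in>UNIV. conv (?b r i) (g i) x) *\<^sub>C e x)"
      by (simp only: scaleC_sum_left) (rule sum.swap)
    then have "(\<Sum>x | length x \<le> N. (cmod (\<Sum>i\<in>UNIV. conv (?b r i) (g i) x))\<^sup>2)
        = (norm (\<Sum>i\<in>UNIV. blinfun_apply (Y i) (?v i)))\<^sup>2"
      by (simp only: norm_sum_orthonormal[OF finite_words_le e])
    also have "\<dots> \<le> \<rho>\<^sup>2 * (\<Sum>i\<in>UNIV. (norm (?v i))\<^sup>2)"
      by (rule \<rho>(3)[unfolded row_bounded_def, rule_format])
    \<comment> \<open>Here \<rho> depends on r and N; only its bound by 1 is uniform.\<close>
    also have "\<dots> \<le> 1 * (\<Sum>i\<in>UNIV. (norm (?v i))\<^sup>2)"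
      using \<rho>(1,2) by (intro mult_right_mono) (simp_all add: power_le_one sum_nonneg)
    finally show ?thesis
      by (simp add: norm_sum_orthonormal[OF finite_words_le e])
  qed
  \<comment> \<open>All sums are finite, so the weights r^|w| may tend to 1 term by term.\<close>
  have "((\<lambda>r. \<Sum>x | length x \<le> N. (cmod (\<Sum>i\<in>UNIV. conv (?b r i) (g i) x))\<^sup>2)
      \<longlongrightarrow> (\<Sum>x | length x \<le> N. (cmod (\<Sum>i\<in>UNIV. conv (?b 1 i) (g i) x))\<^sup>2)) (at_left 1)"
    unfolding conv_def by (intro tendsto_intros)
  moreover have "\<forall>\<^sub>F r in at_left (1 :: real). (\<Sum>x | length x \<le> N. (cmod (\<Sum>i\<in>UNIV. conv (?b r i) (g i) x))\<^sup>2)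
      \<le> (\<Sum>i\<in>UNIV. \<Sum>u | length u \<le> N. (cmod (g i u))\<^sup>2)"
    by (rule eventually_mono[OF eventually_at_left_real[OF zero_less_one]]) (use le in auto)
  ultimately show ?thesis
    using tendsto_upperbound[of _ _ "at_left (1::real)"] by (fastforce simp: trivial_limit_at_left_real)
qed


section \<open>Square summable coefficients\<close>

definition l2 :: "('w \<Rightarrow> complex) \<Rightarrow> bool" where
  "l2 a \<longleftrightarrow> (\<lambda>w. (cmod (a w))\<^sup>2) summable_on UNIV"

definition l2_norm :: "('w \<Rightarrow> complex) \<Rightarrow> real" where
  "l2_norm a = sqrt (\<Sum>\<^sub>\<infinity>w. (cmod (a w))\<^sup>2)"

definition l2_upto :: "nat \<Rightarrow> ('n list \<Rightarrow> complex) \<Rightarrow> real" where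
  "l2_upto N a = L2_set (\<lambda>w. cmod (a w)) {w. length w \<le> N}"

lemma l2_norm_nonneg [simp]: "0 \<le> l2_norm a"
  by (simp add: l2_norm_def infsum_nonneg)

lemma l2_upto_nonneg [simp]: "0 \<le> l2_upto N a"
  by (simp add: l2_upto_def)

lemma l2_upto_power2: "(l2_upto N a)\<^sup>2 = (\<Sum>w | length w \<le> N. (cmod (a w))\<^sup>2)"
  by (simp add: l2_upto_def L2_set_def sum_nonneg)

lemma L2_set_le_l2_norm:
  assumes "l2 a" "finite A"
  shows "L2_set (\<lambda>w. cmod (a w)) A \<le> l2_norm a"
  unfolding l2_norm_def L2_set_def
  using assms by (intro real_sqrt_le_mono finite_sum_le_infsum) (auto simp: l2_def)

lemma l2_upto_le: "l2 a \<Longrightarrow> l2_upto N (a :: 'n::finite list \<Rightarrow> complex) \<le> l2_norm a"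
  unfolding l2_upto_def by (rule L2_set_le_l2_norm) auto

text \<open>Every finite set of words consists of words of bounded length, so a bound uniform in N
  gives summability with the same constant. This is the passage from truncated estimates to
  \<open>l2\<close>.\<close>

lemma l2_upto_bound:
  fixes a :: "'n::finite list \<Rightarrow> complex"
  assumes le: "\<And>N. l2_upto N a \<le> c"
  shows "l2 a" "l2_norm a \<le> c"
proof -
  have c: "0 \<le> c" using le[of 0] l2_upto_nonneg[of 0 a] by linarith
  have fin: "(\<Sum>w\<in>F. (cmod (a w))\<^sup>2) \<le> c\<^sup>2" if "finite F" for F
  proof -
    have "F \<subseteq> {w. length w \<le> Max (length ` F)}" using that by auto
    then have "(\<Sum>w\<in>F. (cmod (a w))\<^sup>2) \<le> (\<Sum>w | length w \<le> Max (length ` F). (cmod (a w))\<^sup>2)"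
      by (intro sum_mono2) auto
    also have "\<dots> \<le> c\<^sup>2"
      unfolding l2_upto_power2[symmetric] by (intro power_mono le) simp
    finally show ?thesis .
  qed
  show l2: "l2 a" unfolding l2_def
    by (rule nonneg_bdd_above_summable_on) (auto intro!: bdd_aboveI2[of _ _ "c\<^sup>2"] fin)
  have "(\<Sum>\<^sub>\<infinity>w. (cmod (a w))\<^sup>2) \<le> c\<^sup>2"
    by (rule infsum_le_finite_sums) (use l2 fin in \<open>auto simp: l2_def\<close>)
  then show "l2_norm a \<le> c"
    unfolding l2_norm_def using c by (simp add: real_le_lsqrt infsum_nonneg)
qed

lemma l2_upto_triangle: "l2_upto N (\<lambda>w. a w + b w) \<le> l2_upto N a + l2_upto N b"
proof -
  have "l2_upto N (\<lambda>w. a w + b w) \<le> L2_set (\<lambda>w. cmod (a w) + cmod (b w)) {w. length w \<le> N}"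
    unfolding l2_upto_def by (rule L2_set_mono) (auto intro: norm_triangle_ineq)
  also have "\<dots> \<le> l2_upto N a + l2_upto N b"
    unfolding l2_upto_def by (rule L2_set_triangle_ineq)
  finally show ?thesis .
qed

lemma l2_upto_mono: "(\<And>w. cmod (a w) \<le> cmod (b w)) \<Longrightarrow> l2_upto N a \<le> l2_upto N b"
  unfolding l2_upto_def by (rule L2_set_mono) auto

lemma l2_mono:
  fixes a b :: "'n::finite list \<Rightarrow> complex"
  assumes "\<And>w. cmod (a w) \<le> cmod (b w)" "l2 b"
  shows "l2 a" "l2_norm a \<le> l2_norm b"
  using l2_upto_bound[of a "l2_norm b"] order_trans[OF l2_upto_mono[OF assms(1)] l2_upto_le[OF assms(2)]]
  by blast+

lemma l2_add:
  fixes a b :: "'n::finite list \<Rightarrow> complex"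
  assumes "l2 a" "l2 b"
  shows "l2 (\<lambda>w. a w + b w)" "l2_norm (\<lambda>w. a w + b w) \<le> l2_norm a + l2_norm b"
  using l2_upto_bound[of "\<lambda>w. a w + b w" "l2_norm a + l2_norm b"]
    order_trans[OF l2_upto_triangle add_mono[OF l2_upto_le[OF assms(1)] l2_upto_le[OF assms(2)]]]
  by blast+

lemma l2_norm_scale: "l2_norm (\<lambda>w. c * a w) = cmod c * l2_norm a"
  by (simp add: l2_norm_def norm_mult power_mult_distrib infsum_cmult_right' real_sqrt_mult)

lemma l2_scale: "l2 a \<Longrightarrow> l2 (\<lambda>w. c * a w)"
  by (simp add: l2_def norm_mult power_mult_distrib summable_on_cmult_right)

lemma l2_minus: "l2 a \<Longrightarrow> l2 (\<lambda>w. - a w)"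
  by (simp add: l2_def)

lemma l2_diff:
  fixes a b :: "'n::finite list \<Rightarrow> complex"
  assumes "l2 a" "l2 b"
  shows "l2 (\<lambda>w. a w - b w)"
  using l2_add(1)[OF assms(1) l2_minus[OF assms(2)]] by simp

lemma l2_zero: "l2 (\<lambda>w. 0)" by (simp add: l2_def)

lemma l2_sum:
  fixes a :: "'i \<Rightarrow> 'n::finite list \<Rightarrow> complex"
  assumes "\<And>i. i \<in> I \<Longrightarrow> l2 (a i)"
  shows "l2 (\<lambda>w. \<Sum>i\<in>I. a i w)"
  using assms by (induction I rule: infinite_finite_induct) (auto simp: l2_zero l2_add)

lemma cmod_le_l2_norm: "l2 a \<Longrightarrow> cmod (a w) \<le> l2_norm a"
  using L2_set_le_l2_norm[of a "{w}"] by simp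

section \<open>The radius condition and convergence on the ball\<close>

lemma radius_condition_mono:
  assumes "radius_condition b" "\<And>w. cmod (a w) \<le> cmod (b w)"
  shows "radius_condition a"
proof -
  have "limsup (\<lambda>k. ereal ((\<Sum>w | length w = k. (cmod (a w))\<^sup>2) powr (1 / (2 * real k))))
     \<le> limsup (\<lambda>k. ereal ((\<Sum>w | length w = k. (cmod (b w))\<^sup>2) powr (1 / (2 * real k))))"
    by (intro Limsup_mono always_eventually allI)
      (auto intro!: powr_mono2 sum_mono power_mono sum_nonneg assms(2))
  then show ?thesis using assms(1) unfolding radius_condition_def by simp
qed

lemma radius_condition_l2:
  fixes a :: "'n::finite list \<Rightarrow> complex"
  assumes "l2 a"
  shows "radius_condition a"
proof -
  \<comment> \<open>The maximum with 1 keeps the base positive, so that its 2k-th roots tend to 1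
    even when a = 0.\<close>
  define M where "M = max 1 ((l2_norm a)\<^sup>2)"
  have "1 \<le> M" by (simp add: M_def)
  have M: "(\<Sum>w | length w = k. (cmod (a w))\<^sup>2) \<le> M" for k
  proof -
    have "(L2_set (\<lambda>w. cmod (a w)) {w. length w = k})\<^sup>2 \<le> (l2_norm a)\<^sup>2"
      by (intro power_mono L2_set_le_l2_norm assms) auto
    then show ?thesis by (simp add: L2_set_def sum_nonneg M_def)
  qed
  have "limsup (\<lambda>k. ereal ((\<Sum>w | length w = k. (cmod (a w))\<^sup>2) powr (1 / (2 * real k))))
     \<le> limsup (\<lambda>k. ereal (M powr (1 / (2 * real k))))"
    by (intro Limsup_mono always_eventually allI)
      (auto intro!: powr_mono2 M sum_nonneg)
  also have "(\<lambda>k. M powr (1 / 2 * (1 / real k))) \<longlonglongrightarrow> M powr (1 / 2 * 0)"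
    using \<open>1 \<le> M\<close> by (intro tendsto_intros lim_1_over_n) simp
  then have "limsup (\<lambda>k. ereal (M powr (1 / (2 * real k)))) = 1"
    using \<open>1 \<le> M\<close> by (intro lim_imp_Limsup) (auto simp: one_ereal_def split: if_splits)
  finally show ?thesis unfolding radius_condition_def .
qed

lemma homogeneous_part_Suc:
  "blinfun_apply (homogeneous_part a (Suc k) X) v
     = (\<Sum>i\<in>UNIV. blinfun_apply (X i) (blinfun_apply (homogeneous_part (\<lambda>u. a (i # u)) k X) v))"
  if "\<And>i. X i \<in> BH"
  unfolding homogeneous_part_apply sum_words_Suc BH_sum[OF that] by simp

text \<open>Peeling off the first letter costs one use of the row bound and gains a factor \<rho>.
  An l2 norm over the words of length k appears, not an l1 norm, because the row is bounded on the
  whole direct sum at once.\<close>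

lemma norm_homogeneous_part:
  fixes X :: "('n::finite, 'h::complex_hilbert) optuple"
  assumes BH: "\<And>i. X i \<in> BH" and \<rho>: "0 \<le> \<rho>" "row_bounded X \<rho>"
  shows "norm (homogeneous_part a k X) \<le> \<rho> ^ k * L2_set (\<lambda>w. cmod (a w)) {w. length w = k}"
proof (rule norm_blinfun_bound)
  fix v
  have "(norm (blinfun_apply (homogeneous_part a k X) v))\<^sup>2
      \<le> (\<rho> ^ k)\<^sup>2 * (\<Sum>w | length w = k. (cmod (a w))\<^sup>2) * (norm v)\<^sup>2"
  proof (induction k arbitrary: a)
    case 0
    then show ?case by (simp add: homogeneous_part_apply norm_scaleC power_mult_distrib)
  next
    case (Suc k)
    have "(norm (blinfun_apply (homogeneous_part a (Suc k) X) v))\<^sup>2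
        \<le> \<rho>\<^sup>2 * (\<Sum>i\<in>UNIV. (norm (blinfun_apply (homogeneous_part (\<lambda>u. a (i # u)) k X) v))\<^sup>2)"
      unfolding homogeneous_part_Suc[OF BH] by (rule \<rho>(2)[unfolded row_bounded_def, rule_format])
    also have "\<dots> \<le> \<rho>\<^sup>2 * (\<Sum>i\<in>UNIV. (\<rho> ^ k)\<^sup>2 * (\<Sum>w | length w = k. (cmod (a (i # w)))\<^sup>2) * (norm v)\<^sup>2)"
      by (intro mult_left_mono sum_mono Suc.IH) auto
    also have "\<dots> = (\<rho> ^ Suc k)\<^sup>2 * (\<Sum>w | length w = Suc k. (cmod (a w))\<^sup>2) * (norm v)\<^sup>2"
      unfolding sum_words_Suc
      by (simp add: sum_distrib_left sum_distrib_right power_mult_distrib mult_ac)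
    finally show ?case .
  qed
  also have "\<dots> = (\<rho> ^ k * L2_set (\<lambda>w. cmod (a w)) {w. length w = k} * norm v)\<^sup>2"
    by (simp add: power_mult_distrib L2_set_def sum_nonneg)
  finally show "norm (blinfun_apply (homogeneous_part a k X) v)
      \<le> \<rho> ^ k * L2_set (\<lambda>w. cmod (a w)) {w. length w = k} * norm v"
    by (rule power2_le_imp_le) (simp add: \<rho>(1))
qed (simp add: \<rho>(1))

lemma norm_homogeneous_part_l2:
  fixes X :: "('n::finite, 'h::complex_hilbert) optuple"
  assumes "\<And>i. X i \<in> BH" "0 \<le> \<rho>" "row_bounded X \<rho>" "l2 a"
  shows "norm (homogeneous_part a k X) \<le> \<rho> ^ k * l2_norm a"
  by (rule order_trans[OF norm_homogeneous_part[OF assms(1-3)]])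
    (intro mult_left_mono L2_set_le_l2_norm assms(4), auto simp: assms(2))

text \<open>The value 0 outside the ball is the convention of \<open>H2_ball\<close>, so that square
  summable sequences parametrise exactly that set.\<close>

definition free_fun ::
  "('n::finite list \<Rightarrow> complex) \<Rightarrow> ('n, 'h::complex_hilbert) optuple \<Rightarrow> 'h bop" where
  "free_fun a X = (if X \<in> op_ball then \<Sum>k. homogeneous_part a k X else 0)"

lemma summable_norm_homogeneous_part:
  fixes X :: "('n::finite, 'h::complex_hilbert) optuple"
  assumes "X \<in> op_ball" "l2 a"
  shows "summable (\<lambda>k. norm (homogeneous_part a k X))"
proof -
  obtain \<rho> where BH: "\<And>i. X i \<in> BH" and \<rho>: "0 \<le> \<rho>" "\<rho> < 1" "row_bounded X \<rho>"
    using assms(1) unfolding op_ball_iff by blast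
  have "summable (\<lambda>k. \<rho> ^ k * l2_norm a)"
    using \<rho> by (intro summable_mult2 summable_geometric) simp
  then show ?thesis
    by (rule summable_comparison_test') (use norm_homogeneous_part_l2[OF BH \<rho>(1,3) assms(2)] in simp)
qed

text \<open>Continuity of point evaluations: K is the sum of the geometric series in \<rho>, which
  depends on X but not on a. It allows limits in \<open>l2\<close> to be identified by their values
  on the ball.\<close>

lemma norm_free_fun_le:
  fixes X :: "('n::finite, 'h::complex_hilbert) optuple"
  assumes "X \<in> op_ball"
  obtains K where "\<And>a. l2 a \<Longrightarrow> norm (free_fun a X) \<le> K * l2_norm a"
proof -
  obtain \<rho> where BH: "\<And>i. X i \<in> BH" and \<rho>: "0 \<le> \<rho>" "\<rho> < 1" "row_bounded X \<rho>"
    using assms(1) unfolding op_ball_iff by blast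
  have "norm (free_fun a X) \<le> (\<Sum>k. \<rho> ^ k) * l2_norm a" if "l2 a" for a
  proof -
    have "norm (\<Sum>k. homogeneous_part a k X) \<le> (\<Sum>k. \<rho> ^ k * l2_norm a)"
      by (rule norm_suminf_le[OF norm_homogeneous_part_l2[OF BH \<rho>(1,3) that]])
        (use \<rho> in \<open>intro summable_mult2 summable_geometric; simp\<close>)
    then show ?thesis using assms \<rho> by (simp add: free_fun_def suminf_mult2 summable_geometric)
  qed
  with that show ?thesis by blast
qed

lemma free_fun_sums:
  fixes X :: "('n::finite, 'h::complex_hilbert) optuple"
  assumes "X \<in> op_ball" "l2 a"
  shows "(\<lambda>k. homogeneous_part a k X) sums free_fun a X"
  using summable_sums[OF summable_norm_cancel[OF summable_norm_homogeneous_part[OF assms]]] assms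
  by (simp add: free_fun_def)

lemma is_free_series_free_fun:
  "l2 a \<Longrightarrow> is_free_series a (free_fun a :: ('n::finite, 'h::complex_hilbert) optuple \<Rightarrow> 'h bop)"
  unfolding is_free_series_iff using radius_condition_l2 free_fun_sums by blast

lemma free_fun_outside: "X \<notin> op_ball \<Longrightarrow> free_fun a X = 0"
  by (simp add: free_fun_def)

lemma free_fun_eqI:
  assumes "is_free_series a f" "\<And>X. X \<notin> op_ball \<Longrightarrow> f X = 0"
  shows "f = free_fun a"
  using assms by (auto simp: fun_eq_iff free_fun_def is_free_series_iff sums_iff)

text \<open>Together with uniqueness of coefficients this makes \<open>free_fun\<close> a bijection
  from \<open>l2\<close> onto the Hardy space, so norms and compositions can be treated on
  coefficients.\<close>

lemma H2_ball_eq: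
  assumes inf: "infinite_dimensional TYPE('h::complex_hilbert)"
  shows "(H2_ball :: (('n::finite, 'h) optuple \<Rightarrow> 'h bop) set) = free_fun ` {a. l2 a}"
proof (intro set_eqI iffI)
  fix f :: "('n, 'h) optuple \<Rightarrow> 'h bop"
  assume f: "f \<in> H2_ball"
  then obtain a where a: "is_free_series a f"
    by (auto simp: H2_ball_def free_holomorphic_def)
  with f have "l2 a" by (simp add: H2_ball_def l2_def coeffs_eq[OF inf a])
  moreover have "f = free_fun a"
    using a f by (intro free_fun_eqI) (auto simp: H2_ball_def)
  ultimately show "f \<in> free_fun ` {a. l2 a}" by blast
next
  fix f :: "('n, 'h) optuple \<Rightarrow> 'h bop"
  assume "f \<in> free_fun ` {a. l2 a}"
  then show "f \<in> H2_ball"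
    using coeffs_eq[OF inf is_free_series_free_fun] is_free_series_free_fun
    by (fastforce simp: H2_ball_def free_holomorphic_def l2_def free_fun_outside)
qed

lemma H2_norm_free_fun:
  assumes inf: "infinite_dimensional TYPE('h::complex_hilbert)" and "l2 a"
  shows "H2_norm (free_fun a :: ('n::finite, 'h) optuple \<Rightarrow> 'h bop) = l2_norm a"
  by (simp add: H2_norm_def l2_norm_def coeffs_eq[OF inf is_free_series_free_fun[OF assms(2)]])

lemma free_fun_inj:
  assumes inf: "infinite_dimensional TYPE('h::complex_hilbert)" and "l2 a" "l2 b"
    and "(free_fun a :: ('n::finite, 'h) optuple \<Rightarrow> 'h bop) = free_fun b"
  shows "a = b"
  using free_series_unique[OF inf is_free_series_free_fun[OF assms(2)]] is_free_series_free_fun[OF assms(3)] assms(4)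
  by metis

lemma homogeneous_part_add:
  "homogeneous_part (\<lambda>w. a w + b w) k X = homogeneous_part a k X + homogeneous_part b k X"
  by (rule blinfun_eqI) (simp add: homogeneous_part_apply blinfun.add_left scaleC_add_left sum.distrib)

lemma homogeneous_part_scale:
  "homogeneous_part (\<lambda>w. c * a w) k X = scaleC_bop c (homogeneous_part a k X)"
  by (rule blinfun_eqI)
    (simp add: homogeneous_part_apply scaleC_bop.rep_eq scaleC_sum_right scaleC_scaleC)

lemma bounded_linear_scaleC_bop: "bounded_linear (scaleC_bop c :: 'h::complex_hilbert bop \<Rightarrow> 'h bop)"
proof (rule bounded_linear_intro[where K = "cmod c"])
  show "norm (scaleC_bop c T) \<le> norm T * cmod c" for T :: "'h bop"
  proof (rule norm_blinfun_bound)
    fix x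
    have "cmod c * norm (blinfun_apply T x) \<le> cmod c * (norm T * norm x)"
      by (intro mult_left_mono norm_blinfun) simp
    then show "norm (blinfun_apply (scaleC_bop c T) x) \<le> norm T * cmod c * norm x"
      by (simp add: scaleC_bop.rep_eq norm_scaleC mult_ac)
  qed simp
qed (auto intro!: blinfun_eqI
    simp: scaleC_bop.rep_eq scaleC_add_right blinfun.add_left blinfun.scaleR_left scaleC_scaleR)

lemma free_fun_add:
  assumes "l2 a" "l2 b"
  shows "free_fun (\<lambda>w. a w + b w) X = free_fun a X + free_fun b X"
proof (cases "X \<in> op_ball")
  case True
  have "(\<lambda>k. homogeneous_part (\<lambda>w. a w + b w) k X) sums (free_fun a X + free_fun b X)"
    unfolding homogeneous_part_add by (intro sums_add free_fun_sums True assms)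
  with free_fun_sums[OF True l2_add(1)[OF assms]] show ?thesis by (rule sums_unique2)
qed (simp add: free_fun_outside)

lemma free_fun_scale:
  assumes "l2 a"
  shows "free_fun (\<lambda>w. c * a w) X = scaleC_bop c (free_fun a X)"
proof (cases "X \<in> op_ball")
  case True
  have "(\<lambda>k. homogeneous_part (\<lambda>w. c * a w) k X) sums scaleC_bop c (free_fun a X)"
    unfolding homogeneous_part_scale
    by (intro bounded_linear.sums[OF bounded_linear_scaleC_bop] free_fun_sums True assms)
  with free_fun_sums[OF True l2_scale[OF assms]] show ?thesis by (rule sums_unique2)
qed (auto simp: free_fun_outside intro!: blinfun_eqI simp: scaleC_bop.rep_eq)

lemma free_fun_diff:
  assumes "l2 a" "l2 b"
  shows "free_fun (\<lambda>w. a w - b w) X = free_fun a X - free_fun b X"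
  using free_fun_add[OF l2_diff[OF assms] assms(2), of X] by simp


section \<open>Boundedness of composition operators\<close>

text \<open>The product of partial sums and the partial Cauchy product differ by the terms in a
  square outside a triangle. Their norms are dominated by the same difference for the series of
  norms, which tends to 0 by the scalar theorem.\<close>

lemma Cauchy_product_blinfun_compose:
  fixes S T :: "nat \<Rightarrow> 'h::banach bop"
  assumes S: "summable (\<lambda>k. norm (S k))" and T: "summable (\<lambda>k. norm (T k))"
  shows "(\<lambda>k. \<Sum>i\<le>k. S i o\<^sub>L T (k - i)) sums ((\<Sum>k. S k) o\<^sub>L (\<Sum>k. T k))"
proof -
  let ?sq = "\<lambda>n. {..<n} \<times> {..<n}" and ?tri = "\<lambda>n. {(i, j). i + j < n}"
  have sub: "?tri n \<subseteq> ?sq n" for n :: nat by auto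
  have square: "(\<Sum>k<n. S k) o\<^sub>L (\<Sum>k<n. T k) = (\<Sum>(i, j)\<in>?sq n. S i o\<^sub>L T j)" for n
    by (rule blinfun_eqI)
      (simp add: blinfun.sum_left blinfun.sum_right sum.cartesian_product[symmetric], rule sum.swap)
  have diff: "((\<Sum>k<n. S k) o\<^sub>L (\<Sum>k<n. T k)) - (\<Sum>k<n. \<Sum>i\<le>k. S i o\<^sub>L T (k - i))
      = (\<Sum>(i, j)\<in>?sq n - ?tri n. S i o\<^sub>L T j)" for n
  proof -
    have "(\<Sum>(i, j)\<in>?sq n - ?tri n. S i o\<^sub>L T j)
        = (\<Sum>(i, j)\<in>?sq n. S i o\<^sub>L T j) - (\<Sum>(i, j)\<in>?tri n. S i o\<^sub>L T j)"
      by (rule sum_diff) (use sub in auto)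
    then show ?thesis
      by (simp only: square sum.triangle_reindex)
  qed
  have diff_norm: "(\<Sum>k<n. norm (S k)) * (\<Sum>k<n. norm (T k)) - (\<Sum>k<n. \<Sum>i\<le>k. norm (S i) * norm (T (k - i)))
      = (\<Sum>(i, j)\<in>?sq n - ?tri n. norm (S i) * norm (T j))" for n
  proof -
    have "(\<Sum>(i, j)\<in>?sq n - ?tri n. norm (S i) * norm (T j))
        = (\<Sum>(i, j)\<in>?sq n. norm (S i) * norm (T j)) - (\<Sum>(i, j)\<in>?tri n. norm (S i) * norm (T j))"
      by (rule sum_diff) (use sub in auto)
    then show ?thesis
      by (simp only: sum_product sum.cartesian_product sum.triangle_reindex)
  qed
  have "(\<lambda>n. (\<Sum>k<n. norm (S k)) * (\<Sum>k<n. norm (T k)) - (\<Sum>k<n. \<Sum>i\<le>k. norm (S i) * norm (T (k - i))))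
      \<longlonglongrightarrow> (\<Sum>k. norm (S k)) * (\<Sum>k. norm (T k)) - (\<Sum>k. norm (S k)) * (\<Sum>k. norm (T k))"
    using Cauchy_product_sums[of "\<lambda>k. norm (S k)" "\<lambda>k. norm (T k)"] S T
    by (intro tendsto_diff tendsto_mult summable_LIMSEQ) (auto simp: sums_def)
  then have lim: "(\<lambda>n. (\<Sum>k<n. norm (S k)) * (\<Sum>k<n. norm (T k)) - (\<Sum>k<n. \<Sum>i\<le>k. norm (S i) * norm (T (k - i))))
      \<longlonglongrightarrow> 0" by simp
  have "(\<lambda>n. ((\<Sum>k<n. S k) o\<^sub>L (\<Sum>k<n. T k)) - (\<Sum>k<n. \<Sum>i\<le>k. S i o\<^sub>L T (k - i))) \<longlonglongrightarrow> 0"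
  proof (rule Lim_null_comparison[OF _ lim])
    show "\<forall>\<^sub>F n in sequentially. norm (((\<Sum>k<n. S k) o\<^sub>L (\<Sum>k<n. T k)) - (\<Sum>k<n. \<Sum>i\<le>k. S i o\<^sub>L T (k - i)))
      \<le> (\<Sum>k<n. norm (S k)) * (\<Sum>k<n. norm (T k)) - (\<Sum>k<n. \<Sum>i\<le>k. norm (S i) * norm (T (k - i)))"
      unfolding diff diff_norm
      by (intro always_eventually allI order_trans[OF norm_sum] sum_mono)
        (auto intro: norm_blinfun_compose)
  qed
  from tendsto_diff[OF _ this] have "(\<lambda>n. \<Sum>k<n. \<Sum>i\<le>k. S i o\<^sub>L T (k - i)) \<longlonglongrightarrow> L"
    if "(\<lambda>n. (\<Sum>k<n. S k) o\<^sub>L (\<Sum>k<n. T k)) \<longlonglongrightarrow> L" for L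
    using that by fastforce
  moreover have "(\<lambda>n. (\<Sum>k<n. S k) o\<^sub>L (\<Sum>k<n. T k)) \<longlonglongrightarrow> ((\<Sum>k. S k) o\<^sub>L (\<Sum>k. T k))"
    by (intro bounded_bilinear.tendsto[OF bounded_bilinear_blinfun_compose] summable_LIMSEQ
        summable_norm_cancel[OF S] summable_norm_cancel[OF T])
  ultimately show ?thesis
    unfolding sums_def by blast
qed

lemma word_op_append: "word_op X (u @ v) = word_op X u o\<^sub>L word_op X v"
  by (induction u) (auto intro!: blinfun_eqI)

lemma word_op_BH: "(\<And>i. X i \<in> BH) \<Longrightarrow> word_op X w \<in> BH"
  by (induction w) (simp_all add: BH_def)

lemma homogeneous_part_conv:
  fixes X :: "('n::finite, 'h::complex_hilbert) optuple"
  assumes BH: "\<And>i. X i \<in> BH"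
  shows "homogeneous_part (conv b g) k X
     = (\<Sum>j\<le>k. homogeneous_part b j X o\<^sub>L homogeneous_part g (k - j) X)"
proof (rule blinfun_eqI)
  fix v
  let ?F = "\<lambda>w u. (b w * g u) *\<^sub>C blinfun_apply (word_op X (w @ u)) v"
  have "blinfun_apply (homogeneous_part (conv b g) k X) v
      = (\<Sum>x | length x = k. \<Sum>j\<le>k. ?F (take j x) (drop j x))"
    unfolding homogeneous_part_apply conv_def scaleC_sum_left by (intro sum.cong) auto
  also have "\<dots> = (\<Sum>j\<le>k. \<Sum>x | length x = k. ?F (take j x) (drop j x))"
    by (rule sum.swap)
  also have "\<dots> = (\<Sum>j\<le>k. \<Sum>(w, u)\<in>{w. length w = j} \<times> {u. length u = k - j}. ?F w u)"
  proof (intro sum.cong refl)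
    fix j assume j: "j \<in> {..k}"
    show "(\<Sum>x | length x = k. ?F (take j x) (drop j x))
        = (\<Sum>(w, u)\<in>{w. length w = j} \<times> {u. length u = k - j}. ?F w u)"
      by (rule sum.reindex_bij_witness[of _ "\<lambda>(w, u). w @ u" "\<lambda>x. (take j x, drop j x)"]) (use j in auto)
  qed
  also have "\<dots> = (\<Sum>j\<le>k. \<Sum>w | length w = j. \<Sum>u | length u = k - j. ?F w u)"
    by (simp add: sum.cartesian_product)
  also have "\<dots> = blinfun_apply (\<Sum>j\<le>k. homogeneous_part b j X o\<^sub>L homogeneous_part g (k - j) X) v"
    by (simp add: blinfun.sum_left homogeneous_part_apply BH_sum[OF word_op_BH[OF BH]]
        scaleC_sum_right scaleC_scaleC word_op_append)
  finally show "blinfun_apply (homogeneous_part (conv b g) k X) v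
      = blinfun_apply (\<Sum>j\<le>k. homogeneous_part b j X o\<^sub>L homogeneous_part g (k - j) X) v" .
qed

text \<open>A product of two functions in the Hardy space may leave it, hence the hypothesis on
  \<open>conv b g\<close>; when b belongs to a self-map, contractivity supplies it.\<close>

lemma free_fun_conv:
  fixes X :: "('n::finite, 'h::complex_hilbert) optuple"
  assumes X: "X \<in> op_ball" and l2: "l2 b" "l2 g" "l2 (conv b g)"
  shows "free_fun (conv b g) X = free_fun b X o\<^sub>L free_fun g X"
proof -
  have BH: "\<And>i. X i \<in> BH" using X unfolding op_ball_iff by blast
  have "(\<lambda>k. homogeneous_part (conv b g) k X) sums (free_fun b X o\<^sub>L free_fun g X)"
    using Cauchy_product_blinfun_compose[OF summable_norm_homogeneous_part[OF X l2(1)]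
        summable_norm_homogeneous_part[OF X l2(2)]] X
    by (simp add: homogeneous_part_conv[OF BH] free_fun_def)
  with free_fun_sums[OF X l2(3)] show ?thesis by (rule sums_unique2)
qed

lemma conv_zero_right [simp]: "conv b (\<lambda>w. 0) = (\<lambda>x. 0)"
  by (simp add: conv_def fun_eq_iff)

lemma conv_diff_right: "conv b (\<lambda>w. g w - h w) x = conv b g x - conv b h x"
  by (simp add: conv_def right_diff_distrib sum_subtractf)

definition unit_coeff :: "complex \<Rightarrow> 'n list \<Rightarrow> complex" where
  "unit_coeff c w = (if w = [] then c else 0)"

lemma conv_unit_coeff: "conv b (unit_coeff 1) = b"
proof
  fix x
  have "conv b (unit_coeff 1) x = (\<Sum>j\<le>length x. if j = length x then b x else 0)"
    unfolding conv_def by (rule sum.cong) (auto simp: unit_coeff_def)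
  then show "conv b (unit_coeff 1) x = b x" by simp
qed

lemma l2_upto_unit_coeff: "l2_upto N (unit_coeff c :: 'n::finite list \<Rightarrow> complex) = cmod c"
proof -
  have "(l2_upto N (unit_coeff c :: 'n list \<Rightarrow> complex))\<^sup>2 = (\<Sum>w :: 'n list | length w \<le> N. if w = [] then (cmod c)\<^sup>2 else 0)"
    unfolding l2_upto_power2 by (rule sum.cong) (auto simp: unit_coeff_def)
  also have "\<dots> = (cmod c)\<^sup>2" by simp
  finally show ?thesis by (simp add: power2_eq_iff_nonneg)
qed

lemma l2_unit_coeff: "l2 (unit_coeff c :: 'n::finite list \<Rightarrow> complex)"
  using l2_upto_bound(1)[of "unit_coeff c :: 'n list \<Rightarrow> complex" "cmod c"] by (simp add: l2_upto_unit_coeff)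

lemma free_fun_unit_coeff:
  fixes X :: "('n::finite, 'h::complex_hilbert) optuple"
  assumes "X \<in> op_ball"
  shows "free_fun (unit_coeff c) X = scaleC_bop c id_blinfun"
proof -
  have "(\<lambda>k. homogeneous_part (unit_coeff c) k X) sums (\<Sum>k\<in>{0}. homogeneous_part (unit_coeff c) k X)"
    by (rule sums_finite) (auto intro!: blinfun_eqI sum.neutral simp: homogeneous_part_apply unit_coeff_def)
  then have "free_fun (unit_coeff c) X = homogeneous_part (unit_coeff c) 0 X"
    using sums_unique2[OF free_fun_sums[OF assms l2_unit_coeff]] by simp
  then show ?thesis by (simp add: homogeneous_part_def unit_coeff_def)
qed

lemma free_fun_sum:
  assumes "\<And>i. i \<in> I \<Longrightarrow> l2 (a i)"
  shows "free_fun (\<lambda>w. \<Sum>i\<in>I. a i w) X = (\<Sum>i\<in>I. free_fun (a i) X)"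
  using assms
proof (induction I rule: infinite_finite_induct)
  case (insert i I)
  then show ?case using free_fun_add[OF _ l2_sum, of "a i" I a X] by simp
next
  case empty
  show ?case using free_fun_diff[OF l2_zero l2_zero, of X] by simp
next
  case (infinite I)
  then show ?case using free_fun_diff[OF l2_zero l2_zero, of X] by simp
qed

section \<open>Littlewood subordination for a fixed self-map\<close>

locale free_self_map_coeffs =
  fixes \<phi> :: "('n::finite, 'h::complex_hilbert) optuple \<Rightarrow> ('n, 'h) optuple"
    and b :: "'n \<Rightarrow> 'n list \<Rightarrow> complex"
  assumes inf: "infinite_dimensional TYPE('h)"
    and maps: "\<And>X. X \<in> op_ball \<Longrightarrow> \<phi> X \<in> op_ball"
    and series: "\<And>i. is_free_series (b i) (\<lambda>X. \<phi> X i)"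
begin

lemma contraction:
  "(l2_upto N (\<lambda>x. \<Sum>i\<in>UNIV. conv (b i) (g i) x))\<^sup>2 \<le> (\<Sum>i\<in>UNIV. (l2_upto N (g i))\<^sup>2)"
  unfolding l2_upto_power2 by (rule self_map_contraction[OF inf maps series])

lemma conv_contraction: "l2_upto N (conv (b i) g) \<le> l2_upto N g"
proof -
  let ?g = "\<lambda>j. if j = i then g else (\<lambda>w. 0)"
  have "(\<lambda>x. \<Sum>j\<in>UNIV. conv (b j) (?g j) x) = conv (b i) g"
  proof
    fix x
    have "(\<Sum>j\<in>UNIV. conv (b j) (?g j) x) = (\<Sum>j\<in>UNIV. if j = i then conv (b i) g x else 0)"
      by (rule sum.cong) auto
    then show "(\<Sum>j\<in>UNIV. conv (b j) (?g j) x) = conv (b i) g x" by simp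
  qed
  moreover have "(\<Sum>j\<in>UNIV. (l2_upto N (?g j))\<^sup>2) = (\<Sum>j\<in>UNIV. if j = i then (l2_upto N g)\<^sup>2 else 0)"
    by (rule sum.cong) (auto simp: l2_upto_def L2_set_def)
  ultimately have "(l2_upto N (conv (b i) g))\<^sup>2 \<le> (l2_upto N g)\<^sup>2"
    using contraction[of N ?g] by simp
  then show ?thesis by (rule power2_le_imp_le) simp
qed

text \<open>The constant 1 is a unit vector, and left multiplication by a component of \<phi> sends
  it to that component, whose norm is therefore at most 1.\<close>

lemma l2_b: "l2 (b i)"
  using conv_contraction[of _ i "unit_coeff 1"] l2_upto_bound(1)[of "b i" 1]
  by (simp add: conv_unit_coeff l2_upto_unit_coeff)

lemma l2_conv: "l2 g \<Longrightarrow> l2 (conv (b i) g)"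
  using l2_upto_bound(1) order_trans[OF conv_contraction l2_upto_le] by blast

lemma free_fun_b: "X \<in> op_ball \<Longrightarrow> free_fun (b i) X = \<phi> X i"
  using free_fun_sums[OF _ l2_b] series sums_unique2 unfolding is_free_series_iff by blast

definition q :: real where "q = L2_set (\<lambda>i. cmod (b i [])) UNIV"

lemma q_nonneg: "0 \<le> q"
  by (simp add: q_def)

text \<open>At the zero tuple all terms of positive degree vanish, so \<phi> takes scalar multiples
  of the identity as its value there. A row of scalars has its Euclidean length as norm, and
  membership in the ball forces this below 1.\<close>

lemma q_less_1: "q < 1"
proof -
  have zero: "(\<lambda>i. 0) \<in> (op_ball :: ('n, 'h) optuple set)"
    unfolding op_ball_iff by (auto simp: BH_def row_bounded_def intro!: exI[of _ 0])
  have "free_fun (b i) (\<lambda>i. 0 :: 'h bop) = scaleC_bop (b i []) id_blinfun" for i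
  proof -
    have "homogeneous_part (b i) k (\<lambda>i. 0 :: 'h bop) = 0" if "k \<noteq> 0" for k
    proof -
      have "word_op (\<lambda>i. 0 :: 'h bop) w = 0" if "length w = k" for w :: "'n list"
        using that \<open>k \<noteq> 0\<close> by (cases w) (auto intro!: blinfun_eqI)
      then show ?thesis by (auto intro!: blinfun_eqI sum.neutral simp: homogeneous_part_apply)
    qed
    then have "(\<lambda>k. homogeneous_part (b i) k (\<lambda>i. 0 :: 'h bop)) sums (\<Sum>k\<in>{0}. homogeneous_part (b i) k (\<lambda>i. 0))"
      by (intro sums_finite) auto
    then show ?thesis
      using sums_unique2[OF free_fun_sums[OF zero l2_b]] by (simp add: homogeneous_part_def)
  qed
  then have \<phi>0: "\<phi> (\<lambda>i. 0) i = scaleC_bop (b i []) id_blinfun" for i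
    using free_fun_b[OF zero] by metis
  obtain \<rho> where \<rho>: "0 \<le> \<rho>" "\<rho> < 1" "row_bounded (\<phi> (\<lambda>i. 0)) \<rho>"
    using maps[OF zero] unfolding op_ball_iff by blast
  obtain e :: "unit \<Rightarrow> 'h" where "orthonormal_on e UNIV"
    using ex_orthonormal_on[OF inf, of "UNIV :: unit set"] by auto
  then have "(norm (e ()))\<^sup>2 = 1"
    by (auto simp: orthonormal_on_def cinner_self simp flip: of_real_power)
  then have "norm (e ()) = 1"
    using power2_eq_imp_eq[of "norm (e ())" 1] by simp
  \<comment> \<open>The conjugate scalars give equality in Cauchy-Schwarz: the row sends this tuple
    to q^2 times \<open>e ()\<close>, while the squared norm of the tuple is q^2.\<close>
  moreover have "(norm (\<Sum>i\<in>UNIV. blinfun_apply (\<phi> (\<lambda>i. 0) i) (cnj (b i []) *\<^sub>C e ())))\<^sup>2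
      \<le> \<rho>\<^sup>2 * (\<Sum>i\<in>UNIV. (norm (cnj (b i []) *\<^sub>C e ()))\<^sup>2)"
    by (rule \<rho>(3)[unfolded row_bounded_def, rule_format])
  moreover have "(\<Sum>i\<in>UNIV. blinfun_apply (\<phi> (\<lambda>i. 0) i) (cnj (b i []) *\<^sub>C e ())) = complex_of_real (q\<^sup>2) *\<^sub>C e ()"
    by (simp add: \<phi>0 scaleC_bop.rep_eq scaleC_scaleC complex_norm_square[symmetric] q_def L2_set_def
        sum_nonneg flip: scaleC_sum_left del: of_real_power)
  moreover have "(\<Sum>i\<in>UNIV. (cmod (b i []))\<^sup>2) = q\<^sup>2"
    by (simp add: q_def L2_set_def sum_nonneg)
  ultimately have "(q\<^sup>2)\<^sup>2 \<le> \<rho>\<^sup>2 * q\<^sup>2"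
    by (simp add: norm_scaleC norm_power)
  then have "q\<^sup>2 \<le> \<rho>\<^sup>2"
    unfolding power2_eq_square[of "q\<^sup>2"] by (cases "q = 0") (simp, metis mult_le_cancel_right_pos zero_less_power2)
  then have "q \<le> \<rho>" using \<rho>(1) by (rule power2_le_imp_le)
  then show ?thesis using \<rho>(2) by simp
qed

text \<open>The coefficients of \<open>\<Sum>a\<^sub>w \<phi>\<^sub>w\<close>, the sum running over the words of length at most \<open>m\<close>, and the
  value of that function at the origin.\<close>

primrec trunc_comp :: "nat \<Rightarrow> ('n list \<Rightarrow> complex) \<Rightarrow> 'n list \<Rightarrow> complex" where
  "trunc_comp 0 a = unit_coeff (a [])"
| "trunc_comp (Suc m) a =
     (\<lambda>x. unit_coeff (a []) x + (\<Sum>i\<in>UNIV. conv (b i) (trunc_comp m (\<lambda>u. a (i # u))) x))"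

primrec trunc_eval :: "nat \<Rightarrow> ('n list \<Rightarrow> complex) \<Rightarrow> complex" where
  "trunc_eval 0 a = a []"
| "trunc_eval (Suc m) a = a [] + (\<Sum>i\<in>UNIV. b i [] * trunc_eval m (\<lambda>u. a (i # u)))"

lemma trunc_comp_Nil: "trunc_comp m a [] = trunc_eval m a"
  by (induction m arbitrary: a) (simp_all add: unit_coeff_def conv_def)

text \<open>The empty word contributes the value at the origin. At every other word the coefficients
  are those of the sum of the \<phi>_i times the composites of the tails, which the row contraction
  controls. After iteration each word w contributes the value at the origin of the composite with
  the coefficients behind the prefix w; \<open>m - length w\<close> is the truncation level left
  once w is peeled off.\<close>

lemma trunc_comp_le_sum_trunc_eval:
  "(l2_upto N (trunc_comp m a))\<^sup>2 \<le> (\<Sum>w | length w \<le> m. (cmod (trunc_eval (m - length w) (\<lambda>u. a (w @ u))))\<^sup>2)"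
proof (induction m arbitrary: a)
  case 0
  have "{w :: 'n list. length w \<le> 0} = {[]}" by auto
  then show ?case by (simp add: l2_upto_unit_coeff)
next
  case (Suc m)
  let ?h = "\<lambda>x. \<Sum>i\<in>UNIV. conv (b i) (trunc_comp m (\<lambda>u. a (i # u))) x"
  let ?A = "{x :: 'n list. length x \<le> N}"
  have "(l2_upto N (trunc_comp (Suc m) a))\<^sup>2
      = (cmod (trunc_comp (Suc m) a []))\<^sup>2 + (\<Sum>x\<in>?A - {[]}. (cmod (trunc_comp (Suc m) a x))\<^sup>2)"
    unfolding l2_upto_power2 by (rule sum.remove) auto
  also have "(\<Sum>x\<in>?A - {[]}. (cmod (trunc_comp (Suc m) a x))\<^sup>2) = (\<Sum>x\<in>?A - {[]}. (cmod (?h x))\<^sup>2)"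
    by (rule sum.cong) (auto simp: unit_coeff_def)
  \<comment> \<open>The empty word is put back at the price of an inequality, so that the
    contraction applies to the full sum.\<close>
  also have "\<dots> \<le> (\<Sum>x\<in>?A. (cmod (?h x))\<^sup>2)"
    by (rule sum_mono2) auto
  also have "\<dots> = (l2_upto N ?h)\<^sup>2"
    by (simp add: l2_upto_power2)
  also have "\<dots> \<le> (\<Sum>i\<in>UNIV. (l2_upto N (trunc_comp m (\<lambda>u. a (i # u))))\<^sup>2)"
    by (rule contraction)
  also have "\<dots> \<le> (\<Sum>i\<in>UNIV. \<Sum>w | length w \<le> m. (cmod (trunc_eval (m - length w) (\<lambda>u. a (i # w @ u))))\<^sup>2)"
    by (intro sum_mono Suc.IH)
  finally show ?case
    unfolding sum_words_le_Suc trunc_comp_Nil by simp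
qed

text \<open>The term q times \<open>l2_upto m G\<close> may be absorbed on the left because it is a
  finite sum and q < 1. The constant depends neither on N nor on the number of peeling steps, which
  permits both limits later.\<close>

lemma trunc_comp_bound: "l2_upto N (trunc_comp m a) \<le> 1 / (1 - q) * l2_upto m a"
proof -
  let ?A = "{w :: 'n list. length w \<le> m}"
  define G where "G w = trunc_eval (m - length w) (\<lambda>u. a (w @ u))" for w
  \<comment> \<open>At length m the truncation leaves no further letter; the value 0 there closes
    the recursion G = a + H.\<close>
  define H where "H w = (if length w < m then \<Sum>i\<in>UNIV. b i [] * G (w @ [i]) else 0)" for w
  have G: "G w = a w + H w" if "length w \<le> m" for w
  proof (cases "length w < m")
    case True
    then have "m - length w = Suc (m - length (w @ [i]))" for i by simp
    then show ?thesis using True by (simp add: G_def H_def)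
  qed (use that in \<open>simp add: G_def H_def\<close>)
  have "l2_upto m H \<le> q * l2_upto m G"
  proof (rule power2_le_imp_le)
    have le: "(cmod (H w))\<^sup>2 \<le> q\<^sup>2 * (\<Sum>i\<in>UNIV. (cmod (G (w @ [i])))\<^sup>2)" if "length w < m" for w
    proof -
      have "cmod (H w) \<le> (\<Sum>i\<in>UNIV. \<bar>cmod (b i [])\<bar> * \<bar>cmod (G (w @ [i]))\<bar>)"
        using that by (auto simp: H_def norm_mult intro: norm_sum order_trans)
      also have "\<dots> \<le> q * L2_set (\<lambda>i. cmod (G (w @ [i]))) UNIV"
        unfolding q_def by (rule L2_set_mult_ineq)
      finally have "(cmod (H w))\<^sup>2 \<le> (q * L2_set (\<lambda>i. cmod (G (w @ [i]))) UNIV)\<^sup>2"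
        by (rule power_mono) simp
      then show ?thesis by (simp add: power_mult_distrib L2_set_def sum_nonneg)
    qed
    have "(l2_upto m H)\<^sup>2 = (\<Sum>w | length w < m. (cmod (H w))\<^sup>2)"
      unfolding l2_upto_power2 by (rule sum.mono_neutral_right) (auto simp: H_def)
    also have "\<dots> \<le> (\<Sum>w | length w < m. q\<^sup>2 * (\<Sum>i\<in>UNIV. (cmod (G (w @ [i])))\<^sup>2))"
      by (rule sum_mono) (use le in auto)
    also have "\<dots> = q\<^sup>2 * (\<Sum>(w, i)\<in>{w. length w < m} \<times> UNIV. (cmod (G (w @ [i])))\<^sup>2)"
      by (simp add: sum_distrib_left sum.cartesian_product case_prod_beta)
    \<comment> \<open>Appending a last letter is injective on pairs, so each word is counted at most
      once.\<close>
    also have "(\<Sum>(w, i)\<in>{w. length w < m} \<times> UNIV. (cmod (G (w @ [i])))\<^sup>2)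
        = (\<Sum>x\<in>(\<lambda>(w, i). w @ [i]) ` ({w. length w < m} \<times> UNIV). (cmod (G x))\<^sup>2)"
      by (subst sum.reindex) (auto simp: inj_on_def case_prod_beta)
    also have "\<dots> \<le> (\<Sum>x\<in>?A. (cmod (G x))\<^sup>2)"
      by (rule sum_mono2) auto
    finally show "(l2_upto m H)\<^sup>2 \<le> (q * l2_upto m G)\<^sup>2"
      by (simp add: power_mult_distrib l2_upto_power2 mult_left_mono)
  qed (simp add: q_nonneg)
  moreover have "l2_upto m G = l2_upto m (\<lambda>w. a w + H w)"
    unfolding l2_upto_def by (rule L2_set_cong) (simp_all add: G)
  ultimately have "l2_upto m G \<le> l2_upto m a + q * l2_upto m G"
    using l2_upto_triangle[of m a H] by linarith
  then have "l2_upto m G \<le> 1 / (1 - q) * l2_upto m a"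
    using q_less_1 by (simp add: field_simps)
  moreover have "l2_upto N (trunc_comp m a) \<le> l2_upto m G"
    by (rule power2_le_imp_le)
      (use trunc_comp_le_sum_trunc_eval[of N m a] in \<open>simp_all add: l2_upto_power2 G_def\<close>)
  ultimately show ?thesis by linarith
qed

lemma l2_trunc_comp: "l2 (trunc_comp m a)"
  by (rule l2_upto_bound(1)[OF trunc_comp_bound])

lemma free_fun_trunc_comp:
  assumes X: "X \<in> op_ball"
  shows "free_fun (trunc_comp m a) X = (\<Sum>w | length w \<le> m. scaleC_bop (a w) (word_op (\<phi> X) w))"
proof (induction m arbitrary: a)
  case 0
  have "{w :: 'n list. length w \<le> 0} = {[]}" by auto
  then show ?case by (simp add: free_fun_unit_coeff[OF X])
next
  case (Suc m)
  have BH: "\<phi> X i \<in> BH" for i using maps[OF X] unfolding op_ball_iff by blast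
  let ?c = "\<lambda>i. conv (b i) (trunc_comp m (\<lambda>u. a (i # u)))"
  have l2: "l2 (?c i)" for i by (intro l2_conv l2_trunc_comp)
  have conv: "free_fun (?c i) X = (\<Sum>u | length u \<le> m. scaleC_bop (a (i # u)) (word_op (\<phi> X) (i # u)))" for i
    unfolding free_fun_conv[OF X l2_b l2_trunc_comp l2] free_fun_b[OF X] Suc.IH
    by (rule blinfun_eqI) (simp add: blinfun.sum_left scaleC_bop.rep_eq BH_sum[OF BH])
  have "free_fun (trunc_comp (Suc m) a) X
      = free_fun (unit_coeff (a [])) X + (\<Sum>i\<in>UNIV. free_fun (?c i) X)"
    using free_fun_add[OF l2_unit_coeff l2_sum[of UNIV ?c, OF l2], of _ X] free_fun_sum[of UNIV ?c X, OF l2] by simp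
  then show ?case
    by (simp add: conv sum_words_le_Suc free_fun_unit_coeff[OF X])
qed

lemma trunc_comp_diff: "trunc_comp m (\<lambda>w. a w - a' w) x = trunc_comp m a x - trunc_comp m a' x"
proof (induction m arbitrary: a a' x)
  case (Suc m)
  have "trunc_comp m (\<lambda>u. a (i # u) - a' (i # u)) = (\<lambda>x. trunc_comp m (\<lambda>u. a (i # u)) x - trunc_comp m (\<lambda>u. a' (i # u)) x)" for i
    by (rule ext) (rule Suc.IH)
  then show ?case by (simp add: conv_diff_right sum_subtractf unit_coeff_def)
qed (simp add: unit_coeff_def)

text \<open>It rewrites a partial composite as one of higher level, so that the difference of two
  levels is a single composite to which the uniform bound applies.\<close>

lemma trunc_comp_cutoff:
  "m \<le> m' \<Longrightarrow> trunc_comp m' (\<lambda>w. if length w \<le> m then a w else 0) = trunc_comp m a"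
proof (induction m arbitrary: m' a)
  case 0
  have "trunc_comp k (\<lambda>w. 0) = (\<lambda>x. 0)" for k
    by (induction k) (simp_all add: unit_coeff_def)
  then show ?case by (cases m') simp_all
next
  case (Suc m)
  then obtain k where "m' = Suc k" "m \<le> k" by (cases m') auto
  then show ?case using Suc.IH by simp
qed

text \<open>Partial composites are Cauchy in \<open>l2\<close>: two levels differ by the composite
  of the coefficients between them, hence by at most K times a tail of a. The limit is taken
  coordinatewise, and continuity of point evaluations identifies its function with the
  composite.\<close>

lemma ex_composition_coeffs:
  assumes a: "l2 a"
  obtains h where "l2 h" "l2_norm h \<le> 1 / (1 - q) * l2_norm a"
    "\<And>X. X \<in> op_ball \<Longrightarrow> free_fun h X = free_fun a (\<phi> X)"
proof -
  define K where "K = 1 / (1 - q)"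
  have K: "0 < K" using q_less_1 by (simp add: K_def)
  define Q where "Q m = (l2_upto m a)\<^sup>2" for m
  have "incseq Q"
    unfolding incseq_def Q_def l2_upto_power2 by (auto intro!: sum_mono2)
  moreover have "Q m \<le> (l2_norm a)\<^sup>2" for m
    unfolding Q_def by (intro power_mono l2_upto_le[OF a]) simp
  ultimately obtain L where L: "Q \<longlonglongrightarrow> L" "\<And>m. Q m \<le> L"
    using incseq_convergent[of Q] by blast
  \<comment> \<open>The difference \<open>L - Q m\<close> bounds the squared norm of the
    coefficients of a between level m and any later level.\<close>
  define \<tau> where "\<tau> m = K * sqrt (L - Q m)" for m
  have \<tau>: "\<tau> \<longlonglongrightarrow> 0"
    unfolding \<tau>_def using tendsto_mult[OF tendsto_const tendsto_real_sqrt[OF tendsto_diff[OF tendsto_const L(1)]], of K L] by simp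
  let ?c = "\<lambda>m. trunc_comp m a"
  have close: "l2_upto N (\<lambda>x. ?c m' x - ?c m x) \<le> \<tau> m" if "m \<le> m'" for N m m'
  proof -
    let ?d = "\<lambda>w. a w - (if length w \<le> m then a w else 0)"
    have "(\<lambda>x. ?c m' x - ?c m x) = trunc_comp m' ?d"
      by (rule ext) (simp add: trunc_comp_diff trunc_comp_cutoff[OF that])
    then have "l2_upto N (\<lambda>x. ?c m' x - ?c m x) \<le> K * l2_upto m' ?d"
      using trunc_comp_bound[of N m' ?d] by (simp add: K_def)
    also have "l2_upto m' ?d \<le> sqrt (L - Q m)"
    proof (rule real_le_rsqrt)
      have "(l2_upto m' ?d)\<^sup>2 = (\<Sum>w\<in>{w. length w \<le> m'} - {w. length w \<le> m}. (cmod (a w))\<^sup>2)"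
        unfolding l2_upto_power2 by (rule sum.mono_neutral_cong_right) auto
      also have "\<dots> = Q m' - Q m"
        unfolding Q_def l2_upto_power2 by (rule sum_diff) (use that in auto)
      finally show "(l2_upto m' ?d)\<^sup>2 \<le> L - Q m" using L(2)[of m'] by simp
    qed
    finally show ?thesis using K by (simp add: \<tau>_def)
  qed
  have "convergent (\<lambda>m. ?c m x)" for x
  proof (rule Cauchy_convergent, rule metric_CauchyI)
    fix \<epsilon> :: real assume "0 < \<epsilon>"
    then obtain M where M: "\<tau> M < \<epsilon> / 2"
      using order_tendstoD(2)[OF \<tau>, of "\<epsilon> / 2"] by (auto simp: eventually_sequentially)
    have near: "cmod (?c m x - ?c M x) < \<epsilon> / 2" if "M \<le> m" for m
    proof -
      have "cmod (?c m x - ?c M x) \<le> l2_upto (length x) (\<lambda>x. ?c m x - ?c M x)"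
        unfolding l2_upto_def by (rule member_le_L2_set) auto
      also have "\<dots> \<le> \<tau> M" by (rule close[OF that])
      finally show ?thesis using M by simp
    qed
    show "\<exists>M. \<forall>m\<ge>M. \<forall>n\<ge>M. dist (?c m x) (?c n x) < \<epsilon>"
      using near by (metis dist_norm dist_triangle_half_l)
  qed
  then obtain h where h: "\<And>x. (\<lambda>m. ?c m x) \<longlonglongrightarrow> h x"
    unfolding convergent_def by metis
  \<comment> \<open>For fixed N only finitely many coordinates enter, so coordinatewise convergence
    suffices. The free g serves both the tail estimate, with a partial composite, and the bound on
    h, with 0.\<close>
  have upto_tendsto: "(\<lambda>m. l2_upto N (\<lambda>x. ?c m x - g x)) \<longlonglongrightarrow> l2_upto N (\<lambda>x. h x - g x)" for N g
    unfolding l2_upto_def L2_set_def by (intro tendsto_intros h)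
  have h_close: "l2_upto N (\<lambda>x. h x - ?c m x) \<le> \<tau> m" for N m
    by (rule LIMSEQ_le_const2[OF upto_tendsto]) (use close in blast)
  have "l2_upto N (\<lambda>x. ?c m x - 0) \<le> K * l2_norm a" for N m
    using order_trans[OF trunc_comp_bound[of N m a] mult_left_mono[OF l2_upto_le[OF a]]] K
    by (simp add: K_def)
  then have h_bound: "l2_upto N h \<le> K * l2_norm a" for N
    using LIMSEQ_le_const2[OF upto_tendsto[of N "\<lambda>x. 0"], of "K * l2_norm a"] by simp
  have h_l2: "l2 h" by (rule l2_upto_bound(1)[OF h_bound])
  show thesis
  proof (rule that[OF h_l2])
    show "l2_norm h \<le> 1 / (1 - q) * l2_norm a"
      using l2_upto_bound(2)[OF h_bound] by (simp add: K_def)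
    fix X :: "('n, 'h) optuple" assume X: "X \<in> op_ball"
    obtain M where M: "\<And>a. l2 a \<Longrightarrow> norm (free_fun a X) \<le> M * l2_norm a"
      using norm_free_fun_le[OF X] by blast
    have "(\<lambda>m. free_fun (?c m) X - free_fun h X) \<longlonglongrightarrow> 0"
    proof (rule Lim_null_comparison)
      show "\<forall>\<^sub>F m in sequentially. norm (free_fun (?c m) X - free_fun h X) \<le> \<bar>M\<bar> * \<tau> m"
      proof (intro always_eventually allI)
        fix m
        have "norm (free_fun (?c m) X - free_fun h X) = norm (free_fun (\<lambda>x. h x - ?c m x) X)"
          by (simp add: free_fun_diff[OF h_l2 l2_trunc_comp] norm_minus_commute)
        also have "\<dots> \<le> M * l2_norm (\<lambda>x. h x - ?c m x)"
          by (intro M l2_diff h_l2 l2_trunc_comp)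
        also have "\<dots> \<le> \<bar>M\<bar> * \<tau> m"
          using l2_upto_bound(2)[OF h_close] by (intro mult_mono) auto
        finally show "norm (free_fun (?c m) X - free_fun h X) \<le> \<bar>M\<bar> * \<tau> m" .
      qed
      show "(\<lambda>m. \<bar>M\<bar> * \<tau> m) \<longlonglongrightarrow> 0"
        using tendsto_mult_right_zero[OF \<tau>] .
    qed
    then have "(\<lambda>m. free_fun (?c m) X) \<longlonglongrightarrow> free_fun h X"
      by (rule LIM_zero_cancel)
    moreover have "free_fun (?c m) X = (\<Sum>k\<le>m. homogeneous_part a k (\<phi> X))" for m
      unfolding free_fun_trunc_comp[OF X] sum_words_le homogeneous_part_def by simp
    moreover have "(\<lambda>m. \<Sum>k\<le>m. homogeneous_part a k (\<phi> X)) \<longlonglongrightarrow> free_fun a (\<phi> X)"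
      using free_fun_sums[OF maps[OF X] a] by (simp add: sums_def_le)
    ultimately show "free_fun h X = free_fun a (\<phi> X)"
      using LIMSEQ_unique by simp
  qed
qed

end


section \<open>The path of dilated composition operators\<close>

text \<open>Symmetry of a metric is demanded for all functions, also outside the carrier. If f has
  no free series, neither has its negative, and both definite descriptions then denote the same
  unspecified sequence.\<close>

lemma coeffs_minus:
  fixes f :: "('n::finite, 'h::complex_hilbert) optuple \<Rightarrow> 'h bop"
  assumes inf: "infinite_dimensional TYPE('h)"
  shows "(\<lambda>w. cmod (coeffs (\<lambda>X. - f X) w)) = (\<lambda>w. cmod (coeffs f w))"
proof -
  have uminus: "is_free_series (\<lambda>w. - a w) (\<lambda>X. - g X)" if "is_free_series a g"
    for a and g :: "('n, 'h) optuple \<Rightarrow> 'h bop"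
  proof -
    have "homogeneous_part (\<lambda>w. - a w) k X = - homogeneous_part a k X" for k and X :: "('n, 'h) optuple"
      by (rule blinfun_eqI)
        (simp add: homogeneous_part_apply scaleC_minus_left sum_negf blinfun.minus_left)
    with that show ?thesis
      unfolding is_free_series_iff by (auto intro: sums_minus radius_condition_mono)
  qed
  show ?thesis
  proof (cases "\<exists>a. is_free_series a f")
    case True
    then obtain a where a: "is_free_series a f" by blast
    show ?thesis
      unfolding coeffs_eq[OF inf a] coeffs_eq[OF inf uminus[OF a]] by simp
  next
    case False
    then have "\<not> (\<exists>a. is_free_series a (\<lambda>X. - f X))"
      using uminus[of _ "\<lambda>X. - f X"] by auto
    with False show ?thesis by (simp add: coeffs_def)
  qed
qed

lemma H2_norm_minus_commute:
  fixes f g :: "('n::finite, 'h::complex_hilbert) optuple \<Rightarrow> 'h bop"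
  assumes "infinite_dimensional TYPE('h)"
  shows "H2_norm (\<lambda>X. f X - g X) = H2_norm (\<lambda>X. g X - f X)"
  using coeffs_minus[OF assms, of "\<lambda>X. f X - g X"] unfolding H2_norm_def by (simp add: fun_eq_iff)

lemma H2_norm_nonneg [simp]: "0 \<le> H2_norm f"
  by (simp add: H2_norm_def infsum_nonneg)

lemma H2_norm_diff_free_fun:
  assumes "infinite_dimensional TYPE('h::complex_hilbert)" "l2 a" "l2 b"
  shows "H2_norm (\<lambda>X. free_fun a X - free_fun b X :: 'h bop) = l2_norm (\<lambda>w :: 'n::finite list. a w - b w)"
  using H2_norm_free_fun[OF assms(1) l2_diff[OF assms(2,3)]] by (simp add: free_fun_diff[OF assms(2,3), symmetric])

lemma l2_norm_eq_0: "l2 a \<Longrightarrow> l2_norm a = 0 \<longleftrightarrow> a = (\<lambda>w. 0)"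
  using cmod_le_l2_norm[of a] by (auto simp: fun_eq_iff l2_norm_def)

lemma Metric_space_H2:
  assumes inf: "infinite_dimensional TYPE('h::complex_hilbert)"
  shows "Metric_space (H2_ball :: (('n::finite, 'h) optuple \<Rightarrow> 'h bop) set) (\<lambda>f g. H2_norm (\<lambda>X. f X - g X))"
proof
  show "0 \<le> H2_norm (\<lambda>X. f X - g X)" for f g :: "('n, 'h) optuple \<Rightarrow> 'h bop"
    by simp
  show "H2_norm (\<lambda>X. f X - g X) = H2_norm (\<lambda>X. g X - f X)" for f g :: "('n, 'h) optuple \<Rightarrow> 'h bop"
    by (rule H2_norm_minus_commute[OF inf])
next
  fix f g :: "('n, 'h) optuple \<Rightarrow> 'h bop"
  assume "f \<in> H2_ball" "g \<in> H2_ball"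
  then obtain a b where [simp]: "f = free_fun a" "g = free_fun b" and l2: "l2 a" "l2 b"
    unfolding H2_ball_eq[OF inf] by blast
  have "H2_norm (\<lambda>X. f X - g X) = 0 \<longleftrightarrow> a = b"
    by (auto simp: H2_norm_diff_free_fun[OF inf l2] l2_norm_eq_0[OF l2_diff[OF l2]] fun_eq_iff)
  then show "H2_norm (\<lambda>X. f X - g X) = 0 \<longleftrightarrow> f = g"
    using free_fun_inj[OF inf l2] by auto
next
  fix f g k :: "('n, 'h) optuple \<Rightarrow> 'h bop"
  assume "f \<in> H2_ball" "g \<in> H2_ball" "k \<in> H2_ball"
  then obtain a b c where [simp]: "f = free_fun a" "g = free_fun b" "k = free_fun c"
    and l2: "l2 a" "l2 b" "l2 c"
    unfolding H2_ball_eq[OF inf] by blast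
  show "H2_norm (\<lambda>X. f X - k X) \<le> H2_norm (\<lambda>X. f X - g X) + H2_norm (\<lambda>X. g X - k X)"
    using l2_add(2)[OF l2_diff[OF l2(1,2)] l2_diff[OF l2(2,3)]]
    by (simp add: H2_norm_diff_free_fun[OF inf] l2)
qed

section \<open>Boundedness and the operator norm metric\<close>

lemma free_self_map_coeffsI:
  fixes \<phi> :: "('n::finite, 'h::complex_hilbert) optuple \<Rightarrow> ('n, 'h) optuple"
  assumes "infinite_dimensional TYPE('h)" "free_self_map \<phi>"
  obtains b where "free_self_map_coeffs \<phi> b"
proof -
  obtain b where "\<And>i. is_free_series (b i) (\<lambda>X. \<phi> X i)"
    using assms(2) unfolding free_self_map_def free_holomorphic_def by metis
  with assms show ?thesis
    by (intro that[of b]) (auto simp: free_self_map_coeffs_def free_self_map_def)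
qed

lemma comp_op_bounded:
  fixes \<phi> :: "('n::finite, 'h::complex_hilbert) optuple \<Rightarrow> ('n, 'h) optuple"
  assumes inf: "infinite_dimensional TYPE('h)" and \<phi>: "free_self_map \<phi>"
  obtains K where "\<And>f. f \<in> H2_ball \<Longrightarrow> comp_op \<phi> f \<in> H2_ball"
    "\<And>f. f \<in> H2_ball \<Longrightarrow> H2_norm (comp_op \<phi> f) \<le> K * H2_norm f"
proof -
  obtain b where "free_self_map_coeffs \<phi> b" by (rule free_self_map_coeffsI[OF assms])
  then interpret free_self_map_coeffs \<phi> b .
  have "comp_op \<phi> f \<in> H2_ball \<and> H2_norm (comp_op \<phi> f) \<le> 1 / (1 - q) * H2_norm f"
    if f: "f \<in> H2_ball" for f :: "('n, 'h) optuple \<Rightarrow> 'h bop"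
  proof -
    obtain a where a: "f = free_fun a" "l2 a" using f unfolding H2_ball_eq[OF inf] by blast
    obtain h where h: "l2 h" "l2_norm h \<le> 1 / (1 - q) * l2_norm a"
      "\<And>X. X \<in> op_ball \<Longrightarrow> free_fun h X = free_fun a (\<phi> X)"
      using ex_composition_coeffs[OF a(2)] by blast
    have "comp_op \<phi> f = free_fun h"
      using f h(3) by (auto simp: comp_op_def a(1) fun_eq_iff free_fun_outside)
    then show ?thesis
      using h(1,2) a by (auto simp: H2_ball_eq[OF inf] H2_norm_free_fun[OF inf])
  qed
  with that show ?thesis by blast
qed

lemma op_norm_le:
  assumes "0 \<le> c" "\<And>f. f \<in> H2_ball \<Longrightarrow> H2_norm f \<le> 1 \<Longrightarrow> H2_norm (D f) \<le> c"
  shows "op_norm D \<le> c"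
  unfolding op_norm_def by (rule enn2real_leI) (auto intro!: SUP_least ennreal_leI assms)

text \<open>An infinite supremum is read as 0 by \<open>op_norm\<close>, so the estimate requires
  some a priori bound K, whose size does not enter the conclusion.\<close>

lemma H2_norm_le_op_norm:
  assumes K: "\<And>f. f \<in> H2_ball \<Longrightarrow> H2_norm f \<le> 1 \<Longrightarrow> H2_norm (D f) \<le> K"
    and f: "f \<in> H2_ball" "H2_norm f \<le> 1"
  shows "H2_norm (D f) \<le> op_norm D"
proof -
  let ?S = "SUP f\<in>{f\<in>H2_ball. H2_norm f \<le> 1}. ennreal (H2_norm (D f))"
  have "?S \<le> ennreal K" by (auto intro!: SUP_least ennreal_leI K)
  then have fin: "?S < top" using ennreal_less_top le_less_trans by blast
  have "ennreal (H2_norm (D f)) \<le> ?S" by (rule SUP_upper) (use f in auto)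
  then have "enn2real (ennreal (H2_norm (D f))) \<le> enn2real ?S"
    by (rule enn2real_mono) (rule fin)
  then show ?thesis by (simp add: op_norm_def)
qed

lemma H2_norm_comp_op_diff_le:
  fixes \<phi> \<psi> :: "('n::finite, 'h::complex_hilbert) optuple \<Rightarrow> ('n, 'h) optuple"
  assumes inf: "infinite_dimensional TYPE('h)" and maps: "free_self_map \<phi>" "free_self_map \<psi>"
    and f: "f \<in> H2_ball" "H2_norm f \<le> 1"
  shows "H2_norm (\<lambda>X. comp_op \<phi> f X - comp_op \<psi> f X) \<le> op_norm (\<lambda>f X. comp_op \<phi> f X - comp_op \<psi> f X)"
proof -
  interpret H2: Metric_space "H2_ball :: (('n, 'h) optuple \<Rightarrow> 'h bop) set" "\<lambda>f g. H2_norm (\<lambda>X. f X - g X)"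
    by (rule Metric_space_H2[OF inf])
  have zero: "(\<lambda>X. 0) \<in> (H2_ball :: (('n, 'h) optuple \<Rightarrow> 'h bop) set)"
  proof -
    have "free_fun (\<lambda>w. 0) X = 0" for X :: "('n, 'h) optuple"
      using free_fun_diff[OF l2_zero l2_zero, of X] by simp
    then have "(\<lambda>X. 0) = (free_fun (\<lambda>w. 0) :: ('n, 'h) optuple \<Rightarrow> 'h bop)" by (simp add: fun_eq_iff)
    then show ?thesis unfolding H2_ball_eq[OF inf] using l2_zero by blast
  qed
  obtain K where K: "\<And>f. f \<in> H2_ball \<Longrightarrow> comp_op \<phi> f \<in> H2_ball"
    "\<And>f. f \<in> H2_ball \<Longrightarrow> H2_norm (comp_op \<phi> f) \<le> K * H2_norm f"
    using comp_op_bounded[OF inf maps(1)] by metis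
  obtain M where M: "\<And>f. f \<in> H2_ball \<Longrightarrow> comp_op \<psi> f \<in> H2_ball"
    "\<And>f. f \<in> H2_ball \<Longrightarrow> H2_norm (comp_op \<psi> f) \<le> M * H2_norm f"
    using comp_op_bounded[OF inf maps(2)] by metis
  show ?thesis
  proof (rule H2_norm_le_op_norm[of _ "\<bar>K\<bar> + \<bar>M\<bar>", OF _ f])
    fix g :: "('n, 'h) optuple \<Rightarrow> 'h bop" assume g: "g \<in> H2_ball" "H2_norm g \<le> 1"
    have le: "c * H2_norm g \<le> \<bar>c\<bar>" for c
      using mult_mono[of c "\<bar>c\<bar>" "H2_norm g" 1] g(2) by simp
    have "H2_norm (\<lambda>X. comp_op \<phi> g X - comp_op \<psi> g X) \<le> H2_norm (comp_op \<phi> g) + H2_norm (comp_op \<psi> g)"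
      using H2.triangle[OF K(1)[OF g(1)] zero M(1)[OF g(1)]]
        H2_norm_minus_commute[OF inf, of "comp_op \<psi> g" "\<lambda>X. 0"] by simp
    then show "H2_norm (\<lambda>X. comp_op \<phi> g X - comp_op \<psi> g X) \<le> \<bar>K\<bar> + \<bar>M\<bar>"
      using K(2)[OF g(1)] M(2)[OF g(1)] le[of K] le[of M] by linarith
  qed
qed

lemma Metric_space_composition_operators:
  assumes inf: "infinite_dimensional TYPE('h::complex_hilbert)"
  shows "Metric_space (composition_operators :: ('n::finite, 'h) H2_operator set)
    (\<lambda>S T. op_norm (\<lambda>f X. S f X - T f X))"
proof
  interpret H2: Metric_space "H2_ball :: (('n, 'h) optuple \<Rightarrow> 'h bop) set" "\<lambda>f g. H2_norm (\<lambda>X. f X - g X)"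
    by (rule Metric_space_H2[OF inf])
  show "0 \<le> op_norm (\<lambda>f X. S f X - T f X)" for S T :: "('n, 'h) H2_operator"
    by (simp add: op_norm_def)
  show "op_norm (\<lambda>f X. S f X - T f X) = op_norm (\<lambda>f X. T f X - S f X)" for S T :: "('n, 'h) H2_operator"
    unfolding op_norm_def by (subst H2_norm_minus_commute[OF inf]) simp
  fix S T :: "('n, 'h) H2_operator"
  assume "S \<in> composition_operators" "T \<in> composition_operators"
  then obtain \<phi> \<psi> where ST: "S = comp_op \<phi>" "T = comp_op \<psi>" and maps: "free_self_map \<phi>" "free_self_map \<psi>"
    unfolding composition_operators_def by blast
  have in_H2: "S f \<in> H2_ball" "T f \<in> H2_ball" if "f \<in> H2_ball" for f
    using comp_op_bounded[OF inf] maps that unfolding ST by metis+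
  show "op_norm (\<lambda>f X. S f X - T f X) = 0 \<longleftrightarrow> S = T"
  proof
    assume 0: "op_norm (\<lambda>f X. S f X - T f X) = 0"
    have unit: "S f = T f" if "f \<in> H2_ball" "H2_norm f \<le> 1" for f
      using H2_norm_comp_op_diff_le[OF inf maps that] 0 H2.zero[OF in_H2[OF that(1)]]
        H2_norm_nonneg[of "\<lambda>X. S f X - T f X"] unfolding ST by linarith
    have "S f X = T f X" if f: "f \<in> H2_ball" and X: "X \<in> op_ball" for f X
    proof -
      obtain a where a: "f = free_fun a" "l2 a" using f unfolding H2_ball_eq[OF inf] by blast
      \<comment> \<open>Vanishing of \<open>op_norm\<close> speaks only about the unit ball, so an
        arbitrary f is scaled into it. The summand 1 avoids a division by zero when a = 0.\<close>
      define c where "c = complex_of_real (1 / (l2_norm a + 1))"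
      have pos: "0 < l2_norm a + 1" by (simp add: add_nonneg_pos)
      then have norm_c: "cmod c = 1 / (l2_norm a + 1)" unfolding c_def norm_of_real by simp
      with pos have "c \<noteq> 0" by auto
      let ?g = "free_fun (\<lambda>w. c * a w) :: ('n, 'h) optuple \<Rightarrow> 'h bop"
      have g: "?g \<in> H2_ball" unfolding H2_ball_eq[OF inf] using l2_scale[OF a(2)] by blast
      have "H2_norm ?g = l2_norm a / (l2_norm a + 1)"
        unfolding H2_norm_free_fun[OF inf l2_scale[OF a(2)]] l2_norm_scale
        by (simp add: norm_c)
      also have "\<dots> \<le> 1" using pos by simp
      finally have "S ?g = T ?g" by (intro unit g)
      then have "S ?g X = T ?g X" by simp
      moreover have "?g Y = scaleC_bop c (f Y)" for Y
        unfolding a(1) by (rule free_fun_scale[OF a(2)])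
      ultimately have "scaleC_bop c (f (\<phi> X)) = scaleC_bop c (f (\<psi> X))"
        using g X by (simp add: ST comp_op_def)
      moreover have "scaleC_bop (inverse c) (scaleC_bop c T) = T" for T :: "'h bop"
        using \<open>c \<noteq> 0\<close> by (intro blinfun_eqI) (simp add: scaleC_bop.rep_eq scaleC_scaleC)
      ultimately have "f (\<phi> X) = f (\<psi> X)" by metis
      then show ?thesis using f X by (simp add: ST comp_op_def)
    qed
    then show "S = T"
      unfolding ST comp_op_def by (intro restrict_ext) (auto simp: fun_eq_iff)
  next
    assume "S = T"
    have "op_norm (\<lambda>f X. S f X - T f X) \<le> 0"
    proof (rule op_norm_le)
      fix f :: "('n, 'h) optuple \<Rightarrow> 'h bop" assume "f \<in> H2_ball"
      then show "H2_norm (\<lambda>X. S f X - T f X) \<le> 0"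
        using H2.zero[OF in_H2(1) in_H2(2), of f f] \<open>S = T\<close> by simp
    qed simp
    then show "op_norm (\<lambda>f X. S f X - T f X) = 0"
      by (simp add: op_norm_def antisym)
  qed
  fix U :: "('n, 'h) H2_operator"
  assume "U \<in> composition_operators"
  then obtain \<theta> where U: "U = comp_op \<theta>" and \<theta>: "free_self_map \<theta>"
    unfolding composition_operators_def by blast
  show "op_norm (\<lambda>f X. S f X - U f X) \<le> op_norm (\<lambda>f X. S f X - T f X) + op_norm (\<lambda>f X. T f X - U f X)"
  proof (rule op_norm_le)
    fix f :: "('n, 'h) optuple \<Rightarrow> 'h bop" assume f: "f \<in> H2_ball" "H2_norm f \<le> 1"
    have "U f \<in> H2_ball" using comp_op_bounded[OF inf \<theta>] f(1) unfolding U by metis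
    from H2.triangle[OF in_H2(1)[OF f(1)] in_H2(2)[OF f(1)] this]
    show "H2_norm (\<lambda>X. S f X - U f X) \<le> op_norm (\<lambda>f X. S f X - T f X) + op_norm (\<lambda>f X. T f X - U f X)"
      using H2_norm_comp_op_diff_le[OF inf maps f] H2_norm_comp_op_diff_le[OF inf maps(2) \<theta> f]
      unfolding ST U by linarith
  qed (simp add: op_norm_def)
qed

section \<open>Dilations of points, coefficients and self-maps\<close>

lemma scaleC_bop_of_real: "scaleC_bop (complex_of_real r) T = r *\<^sub>R T"
  by (rule blinfun_eqI) (simp add: scaleC_bop.rep_eq blinfun.scaleR_left scaleR_scaleC)

lemma op_ball_scaleR:
  assumes X: "X \<in> op_ball" and t: "t \<in> {0..1}"
  shows "(\<lambda>i. t *\<^sub>R X i) \<in> op_ball"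
proof -
  obtain \<rho> where BH: "\<And>i. X i \<in> BH" and \<rho>: "0 \<le> \<rho>" "\<rho> < 1" "row_bounded X \<rho>"
    using X unfolding op_ball_iff by blast
  have "row_bounded (\<lambda>i. t *\<^sub>R X i) \<rho>"
    unfolding row_bounded_def
  proof
    fix v
    have "(norm (\<Sum>i\<in>UNIV. blinfun_apply (t *\<^sub>R X i) (v i)))\<^sup>2
        = t\<^sup>2 * (norm (\<Sum>i\<in>UNIV. blinfun_apply (X i) (v i)))\<^sup>2"
      by (simp add: blinfun.scaleR_left power_mult_distrib flip: scaleR_sum_right)
    also have "\<dots> \<le> 1 * (norm (\<Sum>i\<in>UNIV. blinfun_apply (X i) (v i)))\<^sup>2"
      using t by (intro mult_right_mono) (auto simp: power_le_one)
    also have "\<dots> \<le> \<rho>\<^sup>2 * (\<Sum>i\<in>UNIV. (norm (v i))\<^sup>2)"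
      using \<rho>(3) unfolding row_bounded_def by simp
    finally show "(norm (\<Sum>i\<in>UNIV. blinfun_apply (t *\<^sub>R X i) (v i)))\<^sup>2 \<le> \<rho>\<^sup>2 * (\<Sum>i\<in>UNIV. (norm (v i))\<^sup>2)" .
  qed
  moreover have "t *\<^sub>R X i \<in> BH" for i
    using BH[of i] by (simp add: BH_def blinfun.scaleR_left scaleC_scaleR)
  ultimately show ?thesis using \<rho> unfolding op_ball_iff by blast
qed

text \<open>Since 0^0 = 1, the parameter t = 0 keeps the constant coefficient, so that the path
  starts at the evaluation at the origin.\<close>

definition dilation :: "real \<Rightarrow> ('n list \<Rightarrow> complex) \<Rightarrow> 'n list \<Rightarrow> complex" where
  "dilation t a w = complex_of_real (t ^ length w) * a w"

lemma homogeneous_part_dilation: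
  "homogeneous_part (dilation t a) k X = t ^ k *\<^sub>R homogeneous_part a k X"
  by (rule blinfun_eqI)
    (simp add: homogeneous_part_apply dilation_def blinfun.scaleR_left scaleR_scaleC scaleC_sum_right
      scaleC_scaleC)

lemma word_op_scaleR: "word_op (\<lambda>i. t *\<^sub>R X i) w = t ^ length w *\<^sub>R word_op X w"
  by (induction w) (auto intro!: blinfun_eqI simp: blinfun.scaleR_left blinfun.scaleR_right)

lemma homogeneous_part_scaleR:
  "homogeneous_part a k (\<lambda>i. t *\<^sub>R X i) = t ^ k *\<^sub>R homogeneous_part a k X"
  by (rule blinfun_eqI)
    (simp add: homogeneous_part_apply word_op_scaleR blinfun.scaleR_left scaleC_scaleR scaleR_sum_right)

lemma free_fun_scaleR:
  assumes "X \<in> op_ball" "t \<in> {0..1}"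
  shows "free_fun a (\<lambda>i. t *\<^sub>R X i) = free_fun (dilation t a) X"
  using assms op_ball_scaleR[OF assms]
  by (simp add: free_fun_def homogeneous_part_scaleR homogeneous_part_dilation)

lemma l2_dilation:
  fixes a :: "'n::finite list \<Rightarrow> complex"
  assumes "l2 a" "t \<in> {0..1}"
  shows "l2 (dilation t a)" "l2_norm (dilation t a) \<le> l2_norm a"
proof -
  have "cmod (dilation t a w) \<le> cmod (a w)" for w
    using assms(2) by (simp add: dilation_def norm_mult norm_power mult_left_le_one_le power_le_one)
  then show "l2 (dilation t a)" "l2_norm (dilation t a) \<le> l2_norm a"
    using l2_mono[of "dilation t a" a] assms(1) by blast+
qed

text \<open>The factors |s^k - t^k| are at most 1, though in general not small uniformly in k. This
  keeps the differences in the unit ball, as the compactness argument requires.\<close>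

lemma l2_norm_dilation_diff:
  fixes a :: "'n::finite list \<Rightarrow> complex"
  assumes "l2 a" "s \<in> {0..1}" "t \<in> {0..1}"
  shows "l2_norm (\<lambda>w. dilation s a w - dilation t a w) \<le> l2_norm a"
proof -
  have "cmod (dilation s a w - dilation t a w) \<le> cmod (a w)" for w
  proof -
    have "\<bar>s ^ length w - t ^ length w\<bar> \<le> 1"
      using assms(2,3) by (auto simp: abs_le_iff power_le_one zero_le_power add_increasing2 le_diff_eq diff_le_eq)
    then have "cmod (complex_of_real (s ^ length w - t ^ length w)) \<le> 1"
      by (simp only: norm_of_real)
    then show ?thesis
      by (simp add: dilation_def norm_mult mult_left_le_one_le flip: left_diff_distrib of_real_power of_real_diff)
  qed
  then show ?thesis
    using l2_mono(2)[of "\<lambda>w. dilation s a w - dilation t a w" a] assms(1) by blast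
qed

text \<open>The dilation operators themselves are not norm continuous in the parameter at \<open>1\<close>.\<close>

lemma free_fun_dilation_Lipschitz:
  fixes X :: "('n::finite, 'h::complex_hilbert) optuple"
  assumes X: "X \<in> op_ball"
  obtains M where "\<And>a s t. l2 a \<Longrightarrow> l2_norm a \<le> 1 \<Longrightarrow> s \<in> {0..1} \<Longrightarrow> t \<in> {0..1} \<Longrightarrow>
    norm (free_fun (dilation s a) X - free_fun (dilation t a) X) \<le> M * \<bar>s - t\<bar>"
proof -
  obtain \<rho> where BH: "\<And>i. X i \<in> BH" and \<rho>: "0 \<le> \<rho>" "\<rho> < 1" "row_bounded X \<rho>"
    using X unfolding op_ball_iff by blast
  \<comment> \<open>The homogeneous part of degree k changes by at most k |s - t| \<rho>^k.
    Enlarging k to k + 1 gives the derivative of the geometric series, whose sum is M.\<close>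
  define M where "M = 1 / (1 - \<rho>)\<^sup>2"
  have M: "(\<lambda>k. real (Suc k) * \<rho> ^ k) sums M"
    unfolding M_def using geometric_deriv_sums[of \<rho>] \<rho> by simp
  have "norm (free_fun (dilation s a) X - free_fun (dilation t a) X) \<le> M * \<bar>s - t\<bar>"
    if a: "l2 a" "l2_norm a \<le> 1" and st: "s \<in> {0..1}" "t \<in> {0..1}" for a s t
  proof -
    have sums: "(\<lambda>k. homogeneous_part (dilation s a) k X - homogeneous_part (dilation t a) k X)
        sums (free_fun (dilation s a) X - free_fun (dilation t a) X)"
      by (intro sums_diff free_fun_sums X l2_dilation a st)
    have le: "norm (homogeneous_part (dilation s a) k X - homogeneous_part (dilation t a) k X)
        \<le> real (Suc k) * \<rho> ^ k * \<bar>s - t\<bar>" for k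
    proof -
      have "norm (homogeneous_part (dilation s a) k X - homogeneous_part (dilation t a) k X)
          = \<bar>s ^ k - t ^ k\<bar> * norm (homogeneous_part a k X)"
        by (simp add: homogeneous_part_dilation flip: scaleR_diff_left)
      also have "\<dots> \<le> (real (Suc k) * \<bar>s - t\<bar>) * \<rho> ^ k"
      proof (rule mult_mono)
        have "\<bar>s ^ k - t ^ k\<bar> \<le> real k * \<bar>s - t\<bar>"
          using norm_power_diff[of s t k] st by simp
        also have "\<dots> \<le> real (Suc k) * \<bar>s - t\<bar>"
          by (intro mult_right_mono) auto
        finally show "\<bar>s ^ k - t ^ k\<bar> \<le> real (Suc k) * \<bar>s - t\<bar>" .
        have "norm (homogeneous_part a k X) \<le> \<rho> ^ k * l2_norm a"
          by (rule norm_homogeneous_part_l2[OF BH \<rho>(1,3) a(1)])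
        also have "\<dots> \<le> \<rho> ^ k * 1"
          using a(2) \<rho>(1) by (intro mult_left_mono) auto
        finally show "norm (homogeneous_part a k X) \<le> \<rho> ^ k" by simp
      qed auto
      finally show ?thesis by (simp add: mult_ac)
    qed
    have "norm (\<Sum>k. homogeneous_part (dilation s a) k X - homogeneous_part (dilation t a) k X)
        \<le> (\<Sum>k. real (Suc k) * \<rho> ^ k * \<bar>s - t\<bar>)"
      by (rule norm_suminf_le[OF le]) (rule summable_mult2[OF sums_summable[OF M]])
    then show ?thesis
      using sums_unique[OF sums] sums_unique[OF sums_mult2[OF M, of "\<bar>s - t\<bar>"]] by simp
  qed
  with that show ?thesis by blast
qed

lemma free_self_map_scaleR:
  assumes "free_self_map \<phi>" "t \<in> {0..1}"
  shows "free_self_map (\<lambda>X i. t *\<^sub>R \<phi> X i)"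
proof -
  have "free_holomorphic (\<lambda>X. t *\<^sub>R \<phi> X i)" for i
  proof -
    obtain b where b: "is_free_series b (\<lambda>X. \<phi> X i)"
      using assms(1) unfolding free_self_map_def free_holomorphic_def by blast
    have "radius_condition (\<lambda>w. complex_of_real t * b w)"
      by (rule radius_condition_mono[of b])
        (use b assms(2) in \<open>auto simp: is_free_series_iff norm_mult mult_left_le_one_le\<close>)
    then have "is_free_series (\<lambda>w. complex_of_real t * b w) (\<lambda>X. t *\<^sub>R \<phi> X i)"
      using b by (auto simp: is_free_series_iff homogeneous_part_scale scaleC_bop_of_real intro: sums_scaleR_right)
    then show ?thesis unfolding free_holomorphic_def by blast
  qed
  then show ?thesis
    using assms op_ball_scaleR unfolding free_self_map_def by blast
qed

lemma comp_op_scaleR: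
  fixes \<phi> :: "('n::finite, 'h::complex_hilbert) optuple \<Rightarrow> ('n, 'h) optuple"
  assumes inf: "infinite_dimensional TYPE('h)" and \<phi>: "free_self_map \<phi>" and t: "t \<in> {0..1}" and a: "l2 a"
  shows "comp_op (\<lambda>X i. t *\<^sub>R \<phi> X i) (free_fun a) = comp_op \<phi> (free_fun (dilation t a))"
  using \<phi> a l2_dilation[OF a t] free_fun_scaleR[OF _ t]
  by (auto simp: comp_op_def H2_ball_eq[OF inf] free_self_map_def fun_eq_iff)

text \<open>Dilation maps the unit ball into itself, so the image of the ball under the dilated
  operator lies in its image under \<open>comp_op \<phi>\<close>, and its closure is a closed subset
  of a compact set. The case t = 0 is included.\<close>

lemma compact_operator_comp_op_scaleR:
  fixes \<phi> :: "('n::finite, 'h::complex_hilbert) optuple \<Rightarrow> ('n, 'h) optuple"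
  assumes inf: "infinite_dimensional TYPE('h)" and \<phi>: "free_self_map \<phi>" and t: "t \<in> {0..1}"
    and cpt: "compact_operator (comp_op \<phi>)"
  shows "compact_operator (comp_op (\<lambda>X i. t *\<^sub>R \<phi> X i))"
proof -
  let ?\<phi> = "\<lambda>X i. t *\<^sub>R \<phi> X i" and ?B = "{f \<in> H2_ball :: (('n, 'h) optuple \<Rightarrow> 'h bop) set. H2_norm f \<le> 1}"
  have sub: "comp_op ?\<phi> ` ?B \<subseteq> comp_op \<phi> ` ?B"
  proof
    fix g assume "g \<in> comp_op ?\<phi> ` ?B"
    then obtain a where a: "l2 a" "l2_norm a \<le> 1" and g: "g = comp_op ?\<phi> (free_fun a)"
      by (auto simp: H2_ball_eq[OF inf] H2_norm_free_fun[OF inf])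
    have "free_fun (dilation t a) \<in> ?B"
      using l2_dilation[OF a(1) t] a(2) by (auto simp: H2_ball_eq[OF inf] H2_norm_free_fun[OF inf])
    then show "g \<in> comp_op \<phi> ` ?B"
      unfolding g comp_op_scaleR[OF inf \<phi> t a(1)] by blast
  qed
  have "comp_op ?\<phi> \<in> H2_ball \<rightarrow> H2_ball"
    using comp_op_bounded[OF inf free_self_map_scaleR[OF \<phi> t]] by blast
  moreover have "compactin H2_topology (H2_topology closure_of (comp_op ?\<phi> ` ?B))"
    by (rule closed_compactin[OF _ closure_of_mono[OF sub] closedin_closure_of])
      (use cpt in \<open>simp add: compact_operator_def\<close>)
  ultimately show ?thesis unfolding compact_operator_def ..
qed

text \<open>A sequence witnessing a failure of continuity would give elements \<open>g\<^sub>n\<close> of the unit ball that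
  converge to \<open>0\<close> pointwise but whose images under the compact operator stay away from \<open>0\<close>; any limit
  point of these images is \<open>0\<close>, since point evaluations are continuous.\<close>

lemma comp_op_scaleR_continuous:
  fixes \<phi> :: "('n::finite, 'h::complex_hilbert) optuple \<Rightarrow> ('n, 'h) optuple"
  assumes inf: "infinite_dimensional TYPE('h)" and \<phi>: "free_self_map \<phi>" and t: "t \<in> {0..1}"
    and cpt: "compact_operator (comp_op \<phi>)" and \<epsilon>: "0 < \<epsilon>"
  shows "\<exists>\<delta>>0. \<forall>s\<in>{0..1}. \<bar>s - t\<bar> < \<delta> \<longrightarrow>
    op_norm (\<lambda>f X. comp_op (\<lambda>X i. t *\<^sub>R \<phi> X i) f X - comp_op (\<lambda>X i. s *\<^sub>R \<phi> X i) f X) < \<epsilon>"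
proof (rule ccontr)
  let ?C = "\<lambda>s. comp_op (\<lambda>X i. s *\<^sub>R \<phi> X i)"
  let ?B = "{f \<in> H2_ball :: (('n, 'h) optuple \<Rightarrow> 'h bop) set. H2_norm f \<le> 1}"
  interpret H2: Metric_space "H2_ball :: (('n, 'h) optuple \<Rightarrow> 'h bop) set" "\<lambda>f g. H2_norm (\<lambda>X. f X - g X)"
    by (rule Metric_space_H2[OF inf])
  have top: "H2_topology = H2.mtopology" by (simp add: H2_topology_def)
  assume contra: "\<not> ?thesis"
  let ?P = "\<lambda>n s a. s \<in> {0..1} \<and> \<bar>s - t\<bar> < 1 / real (Suc n) \<and> l2 a \<and> l2_norm a \<le> 1 \<and>
    \<epsilon> / 2 < H2_norm (\<lambda>X. ?C t (free_fun a) X - ?C s (free_fun a) X :: 'h bop)"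
  have "\<exists>s a. ?P n s a" for n
  proof -
    have "0 < 1 / real (Suc n)" by simp
    with contra obtain s where s: "s \<in> {0..1}" "\<bar>s - t\<bar> < 1 / real (Suc n)"
      "\<not> op_norm (\<lambda>f X. ?C t f X - ?C s f X) < \<epsilon>" by blast
    \<comment> \<open>The supremum need not be attained; half of \<epsilon> leaves room for a strict
      inequality at a single f.\<close>
    have "\<exists>f\<in>?B. \<epsilon> / 2 < H2_norm (\<lambda>X. ?C t f X - ?C s f X)"
    proof (rule ccontr)
      assume "\<not> ?thesis"
      then have "op_norm (\<lambda>f X. ?C t f X - ?C s f X) \<le> \<epsilon> / 2"
        using \<epsilon> by (intro op_norm_le) (auto simp: not_less)
      with s(3) \<epsilon> show False by simp
    qed
    then obtain f where f: "f \<in> ?B" "\<epsilon> / 2 < H2_norm (\<lambda>X. ?C t f X - ?C s f X)" by blast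
    then obtain a where a: "f = free_fun a" "l2 a" by (auto simp: H2_ball_eq[OF inf])
    with f(1) have "l2_norm a \<le> 1" by (simp add: H2_norm_free_fun[OF inf])
    with s a f(2) show ?thesis by blast
  qed
  then have "\<forall>n. \<exists>s a. ?P n s a" ..
  then obtain s where "\<forall>n. \<exists>a. ?P n (s n) a" by (rule choice[THEN exE])
  then obtain a where "\<forall>n. ?P n (s n) (a n)" by (rule choice[THEN exE])
  then have s: "\<And>n. s n \<in> {0..1}" "\<And>n. \<bar>s n - t\<bar> < 1 / real (Suc n)"
    and a: "\<And>n. l2 (a n)" "\<And>n. l2_norm (a n) \<le> 1"
    and large: "\<And>n. \<epsilon> / 2 < H2_norm (\<lambda>X. ?C t (free_fun (a n)) X - ?C (s n) (free_fun (a n)) X :: 'h bop)"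
    by blast+
  \<comment> \<open>The difference of the two operators at \<open>free_fun (a n)\<close> is the
    fixed operator \<open>comp_op \<phi>\<close> at the function with coefficients
    \<open>c n\<close>. This trades a varying operator for a varying argument, to which compactness
    applies.\<close>
  define c where "c n = (\<lambda>w. dilation t (a n) w - dilation (s n) (a n) w)" for n
  have c: "l2 (c n)" for n
    unfolding c_def by (intro l2_diff l2_dilation a s t)
  have c_ball: "free_fun (c n) \<in> ?B" for n
    using c[of n] order_trans[OF l2_norm_dilation_diff[OF a(1) t s(1)] a(2)]
    by (auto simp: H2_ball_eq[OF inf] H2_norm_free_fun[OF inf] c_def)
  define y where "y n = comp_op \<phi> (free_fun (c n))" for n
  have y_eq: "y n = (\<lambda>X. ?C t (free_fun (a n)) X - ?C (s n) (free_fun (a n)) X)" for n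
    unfolding comp_op_scaleR[OF inf \<phi> t a(1)] comp_op_scaleR[OF inf \<phi> s(1) a(1)]
    using c[of n] l2_dilation(1)[OF a(1) t] l2_dilation(1)[OF a(1) s(1)]
    by (auto simp: y_def c_def comp_op_def H2_ball_eq[OF inf] free_fun_diff fun_eq_iff)
  have image: "comp_op \<phi> ` ?B \<subseteq> H2_ball"
    using cpt by (auto simp: compact_operator_def)
  have "range y \<subseteq> comp_op \<phi> ` ?B"
    using c_ball by (auto simp: y_def)
  also have "\<dots> \<subseteq> H2.mtopology closure_of (comp_op \<phi> ` ?B)"
    by (rule closure_of_subset) (use image in simp)
  finally obtain l r where r: "strict_mono (r :: nat \<Rightarrow> nat)"
    and lim: "limitin H2.mtopology (y \<circ> r) l sequentially"
    using cpt unfolding compact_operator_def top H2.compactin_sequentially by blast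
  from lim have l: "l \<in> H2_ball" and d: "(\<lambda>n. H2_norm (\<lambda>X. y (r n) X - l X)) \<longlonglongrightarrow> 0"
    by (auto simp: H2.limitin_metric_dist_null comp_def)
  have y_H2: "y n \<in> H2_ball" for n
    using image c_ball by (auto simp: y_def)
  have "l X = 0" for X
  proof (cases "X \<in> op_ball")
    case True
    then have \<phi>X: "\<phi> X \<in> op_ball" using \<phi> by (simp add: free_self_map_def)
    obtain M where M: "\<And>a. l2 a \<Longrightarrow> norm (free_fun a X) \<le> M * l2_norm a"
      using norm_free_fun_le[OF True] by blast
    have eval: "norm (f X - g X) \<le> M * H2_norm (\<lambda>X. f X - g X)" if "f \<in> H2_ball" "g \<in> H2_ball" for f g
      using that M[OF l2_diff] by (auto simp: H2_ball_eq[OF inf] H2_norm_diff_free_fun[OF inf] free_fun_diff)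
    have "(\<lambda>n. y (r n) X - l X) \<longlonglongrightarrow> 0"
    proof (rule Lim_null_comparison)
      show "\<forall>\<^sub>F n in sequentially. norm (y (r n) X - l X) \<le> M * H2_norm (\<lambda>X. y (r n) X - l X)"
        by (intro always_eventually allI eval y_H2 l)
      show "(\<lambda>n. M * H2_norm (\<lambda>X. y (r n) X - l X)) \<longlonglongrightarrow> 0"
        by (rule tendsto_mult_right_zero[OF d])
    qed
    moreover obtain L where L: "\<And>a s t. l2 a \<Longrightarrow> l2_norm a \<le> 1 \<Longrightarrow> s \<in> {0..1} \<Longrightarrow> t \<in> {0..1} \<Longrightarrow>
        norm (free_fun (dilation s a) (\<phi> X) - free_fun (dilation t a) (\<phi> X)) \<le> L * \<bar>s - t\<bar>"
      using free_fun_dilation_Lipschitz[OF \<phi>X] by blast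
    have "(\<lambda>n. y n X) \<longlonglongrightarrow> 0"
    proof (rule Lim_null_comparison)
      show "\<forall>\<^sub>F n in sequentially. norm (y n X) \<le> \<bar>L\<bar> * (1 / real (Suc n))"
      proof (intro always_eventually allI)
        fix n
        have "y n X = free_fun (c n) (\<phi> X)"
          using True c_ball[of n] by (simp add: y_def comp_op_def)
        also have "\<dots> = free_fun (dilation t (a n)) (\<phi> X) - free_fun (dilation (s n) (a n)) (\<phi> X)"
          unfolding c_def by (intro free_fun_diff l2_dilation a s t)
        finally have "norm (y n X) \<le> L * \<bar>t - s n\<bar>"
          using L[OF a t s(1)] by simp
        also have "\<dots> \<le> \<bar>L\<bar> * (1 / real (Suc n))"
          using s(2)[of n] by (intro mult_mono) (auto simp: abs_minus_commute)
        finally show "norm (y n X) \<le> \<bar>L\<bar> * (1 / real (Suc n))" .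
      qed
      show "(\<lambda>n. \<bar>L\<bar> * (1 / real (Suc n))) \<longlonglongrightarrow> 0"
        by (intro tendsto_mult_right_zero LIMSEQ_Suc[OF lim_1_over_n])
    qed
    then have "(\<lambda>n. y (r n) X) \<longlonglongrightarrow> 0"
      using LIMSEQ_subseq_LIMSEQ[OF _ r] by (auto simp: comp_def)
    \<comment> \<open>Both sequences are null, and their difference is the constant
      \<open>l X\<close>.\<close>
    ultimately have "(\<lambda>n. y (r n) X - (y (r n) X - l X)) \<longlonglongrightarrow> 0 - 0"
      by (intro tendsto_diff)
    then show ?thesis by (simp add: LIMSEQ_const_iff)
  next
    case False
    then show ?thesis using l by (simp add: H2_ball_def)
  qed
  then have "(\<lambda>n. H2_norm (y (r n))) \<longlonglongrightarrow> 0" using d by simp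
  moreover have "\<epsilon> / 2 \<le> H2_norm (y (r n))" for n
    using large[of "r n"] by (simp add: y_eq)
  ultimately have "\<epsilon> / 2 \<le> 0" by (intro LIMSEQ_le_const) auto
  with \<epsilon> show False by simp
qed

theorem theorem5p9:
  assumes "separable_space (euclidean :: 'h::complex_hilbert topology)"
    and "infinite_dimensional TYPE('h)"
  shows "path_connectedin composition_operator_topology
           {T \<in> (composition_operators :: ('n::finite, 'h) H2_operator set). compact_operator T}"
proof -
  note inf = assms(2)
  let ?S = "{T \<in> (composition_operators :: ('n, 'h) H2_operator set). compact_operator T}"
  let ?X = "composition_operator_topology :: ('n, 'h) H2_operator topology"
  \<comment> \<open>The common endpoint: at t = 0 the dilated map is constantly 0 whatever \<phi>
    is, so the paths of two compact operators can be concatenated there. Its compactness comes with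
    each such path.\<close>
  let ?C0 = "comp_op (\<lambda>X i. 0) :: ('n, 'h) H2_operator"
  interpret M: Metric_space "composition_operators :: ('n, 'h) H2_operator set" "\<lambda>S T. op_norm (\<lambda>f X. S f X - T f X)"
    by (rule Metric_space_composition_operators[OF inf])
  have top: "?X = M.mtopology" by (simp add: composition_operator_topology_def)
  have path: "path_component_of (subtopology ?X ?S) ?C0 T" if T_in: "T \<in> ?S" for T
  proof -
    obtain \<phi> where T: "T = comp_op \<phi>" and \<phi>: "free_self_map \<phi>" and cpt: "compact_operator (comp_op \<phi>)"
      using T_in unfolding composition_operators_def by blast
    let ?g = "\<lambda>t. comp_op (\<lambda>X i. t *\<^sub>R \<phi> X i)"
    have g_comp: "?g t \<in> composition_operators" if "t \<in> {0..1}" for t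
      using free_self_map_scaleR[OF \<phi> that] unfolding composition_operators_def by blast
    have "continuous_map (top_of_set {0..1}) M.mtopology ?g"
      unfolding M.continuous_map_to_metric
    proof (intro ballI allI impI)
      fix t \<epsilon> :: real
      assume "t \<in> topspace (top_of_set {0..1})" and \<epsilon>: "0 < \<epsilon>"
      then have t: "t \<in> {0..1}" by simp
      obtain \<delta> where \<delta>: "0 < \<delta>" "\<And>s. s \<in> {0..1} \<Longrightarrow> \<bar>s - t\<bar> < \<delta> \<Longrightarrow>
          op_norm (\<lambda>f X. ?g t f X - ?g s f X) < \<epsilon>"
        using comp_op_scaleR_continuous[OF inf \<phi> t cpt \<epsilon>] by blast
      show "\<exists>U. openin (top_of_set {0..1}) U \<and> t \<in> U \<and> (\<forall>s\<in>U. ?g s \<in> M.mball (?g t) \<epsilon>)"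
      proof (intro exI conjI ballI)
        show "openin (top_of_set {0..1}) ({0..1} \<inter> ball t \<delta>)" by (intro openin_open_Int) simp
        show "t \<in> {0..1} \<inter> ball t \<delta>" using t \<delta>(1) by simp
        fix s assume "s \<in> {0..1} \<inter> ball t \<delta>"
        then show "?g s \<in> M.mball (?g t) \<epsilon>"
          using \<delta>(2)[of s] g_comp[OF t] g_comp[of s] by (simp add: dist_real_def abs_minus_commute)
      qed
    qed
    then have "pathin (subtopology ?X ?S) ?g"
      using g_comp compact_operator_comp_op_scaleR[OF inf \<phi> _ cpt]
      by (simp add: pathin_subtopology top) (simp add: pathin_def)
    then show ?thesis
      unfolding path_component_of_def by (intro exI[of _ ?g]) (simp add: T)
  qed
  have "path_component_of (subtopology ?X ?S) T U" if "T \<in> ?S" "U \<in> ?S" for T U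
    using path_component_of_trans[OF path_component_of_sym[OF path[OF that(1)]] path[OF that(2)]] .
  moreover have "?S \<subseteq> topspace ?X" by (auto simp: top)
  ultimately show ?thesis
    unfolding path_connectedin_def path_connected_space_iff_path_component by auto
qed
end
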